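(* Let $K$ be a real closed field with a compatible non-Archimedean absolute value, let $n\in\mathbb{N}$, and let $E=(K^{n+1})^*$. The signed Goldman–Iwahori space is the real tropical linear space associated to the universal realizable oriented valuated matroid $\mathcal{M}_{\mathrm{univ}}$ on $E$: as subspaces of $\mathbb{RP}^E$ (so in particular up to homeomorphism), $$\mathfrak{R}\mathcal{X}_n(K)=\mathrm{Trop}_r(\mathcal{M}_{\mathrm{univ}}).$$
   Context: Standing setting: $K$ is a real closed field with a non-Archimedean absolute value $|\cdot|\colon K\to\mathbb{R}_{\ge0}$ (possibly trivial), compatible with the unique ordering: $0\le a\le b$ implies $|a|\le|b|$. $\mathrm{sgn}\colon K\to\{0,+1,-1\}$ is the sign function. Signed seminorms: a signed seminorm on a finite-dimensional $K$-vector space $V$ is a map $\|\cdot\|^{\mathrm{sgn}}\colon V\to\mathbb{R}$ with (i) $\|\lambda v\|^{\mathrm{sgn}}=\mathrm{sgn}(\lambda)|\lambda|\,\|v\|^{\mathrm{sgn}}$ for $\lambda\in K,v\in V$; (ii) $\min(\|v\|^{\mathrm{sgn}},\|w\|^{\mathrm{sgn}})\le\|v+w\|^{\mathrm{sgn}}\le\max(\|v\|^{\mathrm{sgn}},\|w\|^{\mathrm{sgn}})$ for $v,w\in V$. Homothety means multiplication with a constant in $\mathbb{R}\setminus\{0\}$. $\mathfrak{R}\mathcal{X}_n(K)$ is the set of not identically zero signed seminorms on $E=(K^{n+1})^*$ modulo homothety, with the quotient of the topology of pointwise convergence. $\mathbb{RP}^E:=\big(\mathbb{R}^E\setminus\{0\}\big)/\mathbb{R}^*$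 with the (quotient of the) topology of pointwise convergence. A class $[\|\cdot\|^{\mathrm{sgn}}]$ is regarded as the point $(\|e\|^{\mathrm{sgn}})_{e\in E}$ of $\mathbb{RP}^E$, and $\mathfrak{R}\mathcal{X}_n(K)$ carries the subspace topology of $\mathbb{RP}^E$. Real tropical hyperfield $\mathbb{R}\mathbb{T}$: the set $\mathbb{R}$ with usual multiplication and multivalued addition $a\oplus b=a$ if $|a|>|b|$, $a\oplus b=b$ if $|a|<|b|$, $a\oplus a=a$, and $a\oplus(-a)=[-|a|,|a|]$. For a finite family, $0\in\bigoplus_i a_i$ if and only if either all $a_i=0$, or $\max_i|a_i|$ is attained by both a positive and a negative $a_i$. Universal realizable oriented valuated matroid: $\mathcal{M}_{\mathrm{univ}}$ is the rank $n+1$ oriented valuated matroid on $E$ given by the Grassmann–Plücker function $\varphi_{\mathrm{univ}}\colon E^{n+1}\to\mathbb{R}\mathbb{T}$, $(f_0,\dots,f_n)\mapsto\mathrm{sgn}(\det[f_0,\dots,f_n])\cdot|\det[f_0,\dots,f_n]|$. Real tropical linear space: $\mathrm{Trop}_r(\mathcal{M}_{\mathrm{univ}})\subseteq\mathbb{RP}^E$ is the set of $(y_e)_{e\in E}\in\mathbb{RP}^E$ such that for every $C=(f_0,\dots,f_{n+1})\in E^{n+2}$ one has $0\in\bigoplus_{i=0}^{n+1}(-1)^i\,y_{f_i}\cdot\varphi_{\mathrm{univ}}(C-f_i)$, where $C-f_i$ is the $(n+1)$-tuple obtained from $C$ by omitting its $i$-th entry. It carries the subspace topology. *)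

theory Defs
  imports
    "HOL-Analysis.Product_Topology"
    "HOL-Analysis.Function_Topology"
    "HOL-Computational_Algebra.Polynomial"
    "Jordan_Normal_Form.Determinant"
    "HOL-Algebra.Module"
begin

hide_const (open) Polynomial.smult Modules.module

section \<open>Real closed fields with a compatible absolute value\<close>

text \<open>The ordering is the one of the type class. In a real closed field it is forced: the
  nonnegative elements are exactly the squares.\<close>

definition real_closed :: "'k::linordered_field itself \<Rightarrow> bool" where
  "real_closed _ \<longleftrightarrow>
     (\<forall>a::'k. 0 \<le> a \<longrightarrow> (\<exists>b. b\<^sup>2 = a)) \<and>
     (\<forall>p::'k poly. odd (degree p) \<longrightarrow> (\<exists>x. poly p x = 0))"

definition nonarch_absolute_value :: "('k::field \<Rightarrow> real) \<Rightarrow> bool" where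
  "nonarch_absolute_value v \<longleftrightarrow>
     (\<forall>a. 0 \<le> v a) \<and>
     (\<forall>a. v a = 0 \<longleftrightarrow> a = 0) \<and>
     (\<forall>a b. v (a * b) = v a * v b) \<and>
     (\<forall>a b. v (a + b) \<le> max (v a) (v b))"

definition order_compatible :: "('k::linordered_field \<Rightarrow> real) \<Rightarrow> bool" where
  "order_compatible v \<longleftrightarrow> (\<forall>a b. 0 \<le> a \<and> a \<le> b \<longrightarrow> v a \<le> v b)"

definition sgn_real :: "'k::linordered_field \<Rightarrow> real" where
  "sgn_real a = (if a = 0 then 0 else if 0 < a then 1 else - 1)"

section \<open>Dual spaces and signed seminorms\<close>

text \<open>Maps with a domain \<open>X\<close> that is a proper subset of a type are functions that are
  \<^const>\<open>undefined\<close> outside \<open>X\<close>. The ring components of a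
  \<^type>\<open>Module.module_ext\<close> record are irrelevant for a vector space.\<close>

definition dual_space ::
    "('k::field, 'v, 'm) module_scheme \<Rightarrow> ('k, 'v \<Rightarrow> 'k) module" where
  "dual_space V = \<lparr>
     carrier = {f \<in> carrier V \<rightarrow>\<^sub>E UNIV.
       (\<forall>x\<in>carrier V. \<forall>y\<in>carrier V. f (x \<oplus>\<^bsub>V\<^esub> y) = f x + f y) \<and>
       (\<forall>c. \<forall>x\<in>carrier V. f (c \<odot>\<^bsub>V\<^esub> x) = c * f x)},
     mult = undefined,
     one = undefined,
     zero = (\<lambda>x\<in>carrier V. 0),
     add = (\<lambda>f g. \<lambda>x\<in>carrier V. f x + g x),
     smult = (\<lambda>c f. \<lambda>x\<in>carrier V. c * f x)\<rparr>"

definition signed_seminorm ::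
    "('k::linordered_field \<Rightarrow> real) \<Rightarrow> ('k, 'v, 'm) module_scheme \<Rightarrow> ('v \<Rightarrow> real) \<Rightarrow> bool"
  where
  "signed_seminorm v V N \<longleftrightarrow>
     N \<in> carrier V \<rightarrow>\<^sub>E UNIV \<and>
     (\<forall>c. \<forall>x\<in>carrier V. N (c \<odot>\<^bsub>V\<^esub> x) = sgn_real c * v c * N x) \<and>
     (\<forall>x\<in>carrier V. \<forall>y\<in>carrier V.
        min (N x) (N y) \<le> N (x \<oplus>\<^bsub>V\<^esub> y) \<and> N (x \<oplus>\<^bsub>V\<^esub> y) \<le> max (N x) (N y))"

abbreviation std_dual :: "nat \<Rightarrow> ('k::field, 'k vec \<Rightarrow> 'k) module" where
  "std_dual n \<equiv> dual_space (module_vec TYPE('k) (n + 1))"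

section \<open>The projective space of a set and quotient topologies\<close>

text \<open>The finest topology on \<open>q ` topspace X\<close> for which \<open>q\<close> is continuous.\<close>

definition quotient_topology :: "'a topology \<Rightarrow> ('a \<Rightarrow> 'b) \<Rightarrow> 'b topology" where
  "quotient_topology X q =
     topology (\<lambda>U. U \<subseteq> q ` topspace X \<and> openin X {x \<in> topspace X. q x \<in> U})"

lemma openin_quotient_topology:
  "openin (quotient_topology X q) U \<longleftrightarrow>
     U \<subseteq> q ` topspace X \<and> openin X {x \<in> topspace X. q x \<in> U}"
proof -
  let ?P = "\<lambda>U. U \<subseteq> q ` topspace X \<and> openin X {x \<in> topspace X. q x \<in> U}"
  have "istopology ?P"
    unfolding istopology_def
  proof (intro conjI allI impI)
    fix S T assume ST: "?P S" "?P T"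
    then show "S \<inter> T \<subseteq> q ` topspace X" by blast
    have "{x \<in> topspace X. q x \<in> S \<inter> T} =
        {x \<in> topspace X. q x \<in> S} \<inter> {x \<in> topspace X. q x \<in> T}" by blast
    with ST show "openin X {x \<in> topspace X. q x \<in> S \<inter> T}" by auto
  next
    fix \<K> assume K: "\<forall>K\<in>\<K>. ?P K"
    then show "\<Union>\<K> \<subseteq> q ` topspace X" by blast
    have "{x \<in> topspace X. q x \<in> \<Union>\<K>} = \<Union>((\<lambda>K. {x \<in> topspace X. q x \<in> K}) ` \<K>)" by blast
    with K show "openin X {x \<in> topspace X. q x \<in> \<Union>\<K>}" by auto
  qed
  then show ?thesis
    by (simp add: quotient_topology_def)
qed

lemma topspace_quotient_topology: "topspace (quotient_topology X q) = q ` topspace X"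
proof -
  have "{x \<in> topspace X. q x \<in> q ` topspace X} = topspace X" by blast
  then have "openin (quotient_topology X q) (q ` topspace X)"
    by (simp add: openin_quotient_topology)
  then show ?thesis
    by (metis openin_quotient_topology openin_subset openin_topspace subset_antisym)
qed

lemma quotient_map_quotient_topology: "quotient_map X (quotient_topology X q) q"
  by (auto simp: quotient_map_def topspace_quotient_topology openin_quotient_topology)

definition nonzero_functions :: "'e set \<Rightarrow> ('e \<Rightarrow> real) set" where
  "nonzero_functions E = (E \<rightarrow>\<^sub>E UNIV) - {\<lambda>e\<in>E. 0}"

definition homothety_class :: "'e set \<Rightarrow> ('e \<Rightarrow> real) \<Rightarrow> ('e \<Rightarrow> real) set" where
  "homothety_class E y = {z. \<exists>c. c \<noteq> 0 \<and> z = (\<lambda>e\<in>E. c * y e)}"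

text \<open>The product topology \<open>powertop_real\<close> is the topology of pointwise convergence.\<close>

definition RP_topology :: "'e set \<Rightarrow> ('e \<Rightarrow> real) set topology" where
  "RP_topology E =
     quotient_topology (subtopology (powertop_real E) (nonzero_functions E)) (homothety_class E)"

section \<open>The signed Goldman-Iwahori space\<close>

definition nonzero_signed_seminorms ::
    "('k::linordered_field \<Rightarrow> real) \<Rightarrow> nat \<Rightarrow> (('k vec \<Rightarrow> 'k) \<Rightarrow> real) set" where
  "nonzero_signed_seminorms v n =
     {N. signed_seminorm v (std_dual n) N \<and> (\<exists>f\<in>carrier (std_dual n). N f \<noteq> 0)}"

text \<open>The homothety class of a signed seminorm consists of signed seminorms, so its class modulo
  homothety among signed seminorms is the same set as the point of the projective space that it
  represents.\<close>

definition signed_GI_space ::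
    "('k::linordered_field \<Rightarrow> real) \<Rightarrow> nat \<Rightarrow> (('k vec \<Rightarrow> 'k) \<Rightarrow> real) set set" where
  "signed_GI_space v n =
     homothety_class (carrier (std_dual n)) ` nonzero_signed_seminorms v n"

definition signed_GI_topology ::
    "('k::linordered_field \<Rightarrow> real) \<Rightarrow> nat \<Rightarrow> (('k vec \<Rightarrow> 'k) \<Rightarrow> real) set topology" where
  "signed_GI_topology v n =
     quotient_topology
       (subtopology (powertop_real (carrier (std_dual n))) (nonzero_signed_seminorms v n))
       (homothety_class (carrier (std_dual n)))"

section \<open>The real tropical hyperfield\<close>

definition rt_add :: "real \<Rightarrow> real \<Rightarrow> real set" where
  "rt_add a b =
     (if \<bar>a\<bar> > \<bar>b\<bar> then {a}
      else if \<bar>a\<bar> < \<bar>b\<bar> then {b}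
      else if a = b then {a}
      else {- \<bar>a\<bar>..\<bar>a\<bar>})"

fun rt_sum :: "real list \<Rightarrow> real set" where
  "rt_sum [] = {0}"
| "rt_sum (a # as) = (\<Union>s\<in>rt_sum as. rt_add a s)"

section \<open>Real tropical linear spaces\<close>

text \<open>\<open>trop_real E r \<phi>\<close> is the real tropical linear space of the rank \<open>r\<close> oriented valuated
  matroid on \<open>E\<close> with Grassmann-Pluecker function \<open>\<phi>\<close>, whose arguments are the tuples, as lists,
  of length \<open>r\<close> with entries in \<open>E\<close>. The multiplication of the hyperfield is that of the reals,
  and the defining condition does not depend on the representative \<open>y\<close>.\<close>

definition trop_real :: "'e set \<Rightarrow> nat \<Rightarrow> ('e list \<Rightarrow> real) \<Rightarrow> ('e \<Rightarrow> real) set set" where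
  "trop_real E r \<phi> = homothety_class E ` {y \<in> nonzero_functions E.
     \<forall>C. length C = r + 1 \<and> set C \<subseteq> E \<longrightarrow>
       0 \<in> rt_sum (map (\<lambda>i. (- 1) ^ i * y (C ! i) * \<phi> (take i C @ drop (Suc i) C)) [0..<r + 1])}"

text \<open>Column \<open>j\<close> of the matrix holds the coordinates of the \<open>j\<close>-th functional in the dual standard
  basis.\<close>

definition functional_det :: "nat \<Rightarrow> ('k::field vec \<Rightarrow> 'k) list \<Rightarrow> 'k" where
  "functional_det n fs =
     Determinant.det (mat (n + 1) (n + 1) (\<lambda>(i, j). (fs ! j) (unit_vec (n + 1) i)))"

definition phi_univ ::
    "('k::linordered_field \<Rightarrow> real) \<Rightarrow> nat \<Rightarrow> ('k vec \<Rightarrow> 'k) list \<Rightarrow> real" where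
  "phi_univ v n fs = sgn_real (functional_det n fs) * v (functional_det n fs)"

definition trop_univ ::
    "('k::linordered_field \<Rightarrow> real) \<Rightarrow> nat \<Rightarrow> (('k vec \<Rightarrow> 'k) \<Rightarrow> real) set set" where
  "trop_univ v n = trop_real (carrier (std_dual n)) (n + 1) (phi_univ v n)"

end

theory Submission
  imports Defs
begin

text \<open>
  Both spaces are images of sets of functions on the dual space \<open>E\<close> under the same projection, and
  in fact the two sets of functions coincide: a function \<open>y\<close> on \<open>E\<close> is a signed seminorm if and only
  if it satisfies the circuit condition \<open>0 \<in> \<Oplus>\<^sub>i (-1)\<^sup>i y(f\<^sub>i) \<phi>(C - f\<^sub>i)\<close> for all tuples
  \<open>C = (f\<^sub>0, \<dots>, f\<^sub>m)\<close> of \<open>m + 1\<close> functionals on \<open>K\<^sup>m\<close>, where \<open>m = n + 1\<close>. A hyperfield sum contains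
  zero exactly if the largest absolute value of its terms is zero or attained with both signs
  (\<open>zero_in_rt_sum_iff\<close>). Both directions rest on one linear relation, Cramer's rule
  \<open>\<Sum>\<^sub>i (-1)\<^sup>i det(C - f\<^sub>i) f\<^sub>i = 0\<close> (\<open>cramer_relation\<close>).

  If \<open>y\<close> is a signed seminorm, then its values on the terms of any linear relation sum to zero in the
  hyperfield (\<open>seminorm_of_relation_vanishes\<close>): if a term had the largest value \<open>M > 0\<close> while all
  terms had values above \<open>-M\<close>, then so would the sum of the other terms; but that sum is the negative
  of the first term, with value \<open>-M\<close>. Cramer's rule is such a relation.

  Conversely, let \<open>y\<close> satisfy the circuit condition. If \<open>f = \<Sum>\<^sub>j a\<^sub>j b\<^sub>j\<close> for a basis \<open>b\<close>, then
  comparing this with Cramer's rule for the tuple \<open>(f, b\<^sub>0, \<dots>, b\<^bsub>m-1\<^esub>)\<close> identifies its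
  remaining determinants as \<open>\<plusminus> a\<^sub>j det(b)\<close>, and after division by \<open>det(b)\<close> the circuit condition compares
  \<open>y(f)\<close> with the \<open>a\<^sub>j y(b\<^sub>j)\<close> (\<open>circuit_condition_expansion\<close>). A basis that starts with \<open>g\<close> and
  \<open>f = c g\<close> give homogeneity; a basis that starts with \<open>g, h\<close> and \<open>f = g + h\<close> give the two
  inequalities. If \<open>g\<close> and \<open>h\<close> are proportional, the inequalities follow from homogeneity and the same
  inequalities for the signed absolute value of \<open>K\<close>, where the compatibility with the
  ordering enters (\<open>signed_abs_add_between\<close>).

  For the topologies, the projection to projective space is an open map, because it is the quotient by
  the group of homotheties, which act by homeomorphisms. An open quotient map restricts to a quotient
  map on each saturated subset, and the signed seminorms form one
  (\<open>quotient_of_saturated_subset\<close>).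
\<close>

section \<open>Sums in the real tropical hyperfield\<close>

text \<open>The values of a nonempty family whose hyperfield sum contains zero. The condition \<open>\<bar>x\<bar> \<le> M\<close> forces
  \<open>M \<ge> 0\<close>, so that for \<open>M = 0\<close> all values are zero and for \<open>M > 0\<close> the bound is attained with both
  signs. A set suffices, since multiplicities do not change the sum.\<close>

definition tropically_vanishing :: "real set \<Rightarrow> bool" where
  "tropically_vanishing X \<longleftrightarrow> (\<exists>M\<in>X. - M \<in> X \<and> (\<forall>x\<in>X. \<bar>x\<bar> \<le> M))"

lemma tropically_vanishingI:
  assumes "M \<in> X" "- M \<in> X" "\<And>x. x \<in> X \<Longrightarrow> \<bar>x\<bar> \<le> M"
  shows "tropically_vanishing X"
  using assms unfolding tropically_vanishing_def by blast

lemma in_rt_add_iff: "c \<in> rt_add a b \<longleftrightarrow> tropically_vanishing {- c, a, b}"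
  unfolding rt_add_def tropically_vanishing_def by (simp split: if_splits) (smt (verit))

text \<open>Eliminating \<open>s\<close> from two vanishing families, as when two equations are added: at the larger of the
  two bounds, a given sign is supplied by \<open>s\<close> or by \<open>- s\<close> in at most one of the two families.\<close>

lemma tropically_vanishing_glue:
  assumes "tropically_vanishing {p, q, s}" "tropically_vanishing (insert (- s) X)"
  shows "tropically_vanishing (insert p (insert q X))"
proof -
  obtain M where "M \<in> {p, q, s}" "- M \<in> {p, q, s}" "\<forall>x\<in>{p, q, s}. \<bar>x\<bar> \<le> M"
    using assms(1) unfolding tropically_vanishing_def by blast
  then have M: "M = p \<or> M = q \<or> M = s" "- M = p \<or> - M = q \<or> - M = s"
      "\<bar>p\<bar> \<le> M" "\<bar>q\<bar> \<le> M" "\<bar>s\<bar> \<le> M" by auto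
  obtain L where "L \<in> insert (- s) X" "- L \<in> insert (- s) X" "\<forall>x\<in>insert (- s) X. \<bar>x\<bar> \<le> L"
    using assms(2) unfolding tropically_vanishing_def by blast
  then have L: "L = - s \<or> L \<in> X" "- L = - s \<or> - L \<in> X" "\<bar>s\<bar> \<le> L" "\<forall>x\<in>X. \<bar>x\<bar> \<le> L"
    by auto
  define R where "R = max M L"
  have "\<bar>x\<bar> \<le> R" if "x \<in> insert p (insert q X)" for x
    using that M(3,4) L(4) unfolding R_def by (elim insertE) (simp_all add: le_max_iff_disj)
  moreover have "R \<in> insert p (insert q X)"
  proof (cases "L < M \<or> L \<in> X")
    case True
    show ?thesis
    proof (cases "L < M")
      case True
      then have "R = M" "M \<noteq> s" using L(3) by (simp_all add: R_def)
      then show ?thesis using M(1) by blast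
    next
      case False
      then show ?thesis using True by (simp add: R_def max_def)
    qed
  next
    case False
    \<comment> \<open>In the second family only \<open>- s\<close> attains the bound with this sign.
      Hence the bounds agree, and in the first family \<open>p\<close> or \<open>q\<close> attains it.\<close>
    then have "L = - s" "M \<le> L" using L(1) by simp_all
    then have "M = L" using M(5) L(3) by linarith
    then have "R = L" by (simp add: R_def)
    moreover have "M = p \<or> M = q"
      using M(1,3,4) \<open>L = - s\<close> \<open>M = L\<close> by linarith
    ultimately show ?thesis using \<open>M = L\<close> by blast
  qed
  moreover have "- R \<in> insert p (insert q X)"
  proof (cases "L < M \<or> - L \<in> X")
    case True
    show ?thesis
    proof (cases "L < M")
      case True
      then have "R = M" "- M \<noteq> s" using L(3) by (simp_all add: R_def)
      then show ?thesis using M(2) by blast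
    next
      case False
      then show ?thesis using True by (simp add: R_def max_def)
    qed
  next
    case False
    \<comment> \<open>In the second family only \<open>- s\<close> attains the bound with this sign.
      Hence the bounds agree, and in the first family \<open>p\<close> or \<open>q\<close> attains it.\<close>
    then have "- L = - s" "M \<le> L" using L(2) by simp_all
    then have "M = L" using M(5) L(3) by linarith
    then have "R = L" by (simp add: R_def)
    moreover have "- M = p \<or> - M = q"
      using M(2,3,4) \<open>- L = - s\<close> \<open>M = L\<close> by linarith
    ultimately show ?thesis using \<open>M = L\<close> by blast
  qed
  ultimately show ?thesis by (intro tropically_vanishingI[of R])
qed

text \<open>The converse of the elimination: a partial sum \<open>s\<close> can be chosen. When \<open>p\<close> and \<open>q\<close> attain the bound
  with both signs by themselves, every \<open>s\<close> within the bound suits them, and \<open>s\<close> is taken to cancel an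
  element of \<open>X\<close> of largest absolute value.\<close>

lemma tropically_vanishing_split:
  assumes "finite X" "tropically_vanishing (insert p (insert q X))"
  shows "\<exists>s. tropically_vanishing {p, q, s} \<and> tropically_vanishing (insert (- s) X)"
proof -
  obtain M where M: "M \<in> insert p (insert q X)" "- M \<in> insert p (insert q X)"
      "\<forall>x\<in>insert p (insert q X). \<bar>x\<bar> \<le> M"
    using assms(2) unfolding tropically_vanishing_def by blast
  have bounds: "\<bar>p\<bar> \<le> M" "\<bar>q\<bar> \<le> M" "\<And>x. x \<in> X \<Longrightarrow> \<bar>x\<bar> \<le> M" using M(3) by blast+
  have "M \<ge> 0" using bounds(1) by linarith
  consider (both) "M \<in> X" "- M \<in> X" | (plus) "M \<in> X" "- M \<in> {p, q}"
    | (minus) "- M \<in> X" "M \<in> {p, q}" | (none) "M \<in> {p, q}" "- M \<in> {p, q}"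
    using M(1,2) by blast
  then show ?thesis
  proof cases
    case both
    \<comment> \<open>The bound is attained within \<open>X\<close>, so \<open>s\<close> only has to cancel the larger of \<open>p\<close> and \<open>q\<close>.\<close>
    define s where "s = (if \<bar>p\<bar> \<le> \<bar>q\<bar> then - q else - p)"
    have "tropically_vanishing {p, q, s}"
      by (rule tropically_vanishingI[of "max \<bar>p\<bar> \<bar>q\<bar>"]) (auto simp: s_def max_def abs_if)
    moreover have "tropically_vanishing (insert (- s) X)"
      by (rule tropically_vanishingI[of M]) (use both bounds in \<open>auto simp: s_def\<close>)
    ultimately show ?thesis by blast
  next
    case plus
    have "tropically_vanishing {p, q, M}"
      by (rule tropically_vanishingI[of M]) (use plus bounds \<open>M \<ge> 0\<close> in auto)
    moreover have "tropically_vanishing (insert (- M) X)"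
      by (rule tropically_vanishingI[of M]) (use plus bounds \<open>M \<ge> 0\<close> in auto)
    ultimately show ?thesis by blast
  next
    case minus
    have "tropically_vanishing {p, q, - M}"
      by (rule tropically_vanishingI[of M]) (use minus bounds \<open>M \<ge> 0\<close> in auto)
    moreover have "tropically_vanishing (insert (- (- M)) X)"
      by (rule tropically_vanishingI[of M]) (use minus bounds \<open>M \<ge> 0\<close> in auto)
    ultimately show ?thesis by blast
  next
    case none
    have "\<exists>s. \<bar>s\<bar> \<le> M \<and> tropically_vanishing (insert (- s) X)"
    proof (cases "X = {}")
      case True
      then show ?thesis
        using \<open>M \<ge> 0\<close> by (intro exI[of _ 0] conjI tropically_vanishingI[of 0]) auto
    next
      case False
      then have "Max (abs ` X) \<in> abs ` X" using assms(1) by (intro Max_in) auto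
      then obtain s where s: "s \<in> X" "Max (abs ` X) = \<bar>s\<bar>" by blast
      have le: "\<bar>x\<bar> \<le> \<bar>s\<bar>" if "x \<in> X" for x
        unfolding s(2)[symmetric] using assms(1) that by (intro Max_ge) auto
      have "tropically_vanishing (insert (- s) X)"
      proof (rule tropically_vanishingI[of "\<bar>s\<bar>"])
        show "\<bar>s\<bar> \<in> insert (- s) X" "- \<bar>s\<bar> \<in> insert (- s) X"
          using s(1) by (cases "s \<ge> 0", simp_all)+
        show "\<bar>x\<bar> \<le> \<bar>s\<bar>" if "x \<in> insert (- s) X" for x
          using that le by (elim insertE) simp_all
      qed
      then show ?thesis using bounds(3) s(1) by blast
    qed
    moreover have "tropically_vanishing {p, q, s}" if "\<bar>s\<bar> \<le> M" for s
      by (rule tropically_vanishingI[of M]) (use none bounds that in blast)+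
    ultimately show ?thesis by blast
  qed
qed

text \<open>Membership in a sum is moved to the question whether zero lies in a longer sum, which makes the
  induction go through: the quantifier over partial sums is eliminated by the two lemmas above.\<close>

lemma in_rt_sum_iff: "c \<in> rt_sum xs \<longleftrightarrow> tropically_vanishing (insert (- c) (set xs))"
proof (induction xs arbitrary: c)
  case Nil
  then show ?case by (auto simp: tropically_vanishing_def)
next
  case (Cons a xs)
  have "c \<in> rt_sum (a # xs) \<longleftrightarrow>
      (\<exists>s. tropically_vanishing {- c, a, s} \<and> tropically_vanishing (insert (- s) (set xs)))"
    using Cons.IH by (auto simp: in_rt_add_iff)
  also have "\<dots> \<longleftrightarrow> tropically_vanishing (insert (- c) (insert a (set xs)))"
    using tropically_vanishing_glue tropically_vanishing_split[OF finite_set] by blast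
  finally show ?case by simp
qed

lemma zero_in_rt_sum_iff:
  assumes "xs \<noteq> []"
  shows "0 \<in> rt_sum xs \<longleftrightarrow> tropically_vanishing (set xs)"
proof -
  have "tropically_vanishing (insert 0 (set xs)) \<longleftrightarrow> tropically_vanishing (set xs)"
  proof
    assume "tropically_vanishing (insert 0 (set xs))"
    then obtain M where M: "M \<in> insert 0 (set xs)" "- M \<in> insert 0 (set xs)"
        "\<forall>x\<in>insert 0 (set xs). \<bar>x\<bar> \<le> M"
      unfolding tropically_vanishing_def by blast
    show "tropically_vanishing (set xs)"
    proof (cases "M = 0")
      case True
      then have "\<forall>x\<in>set xs. x = 0" using M(3) by simp
      moreover have "hd xs \<in> set xs" using assms by simp
      ultimately show ?thesis by (intro tropically_vanishingI[of 0]) auto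
    next
      case False
      then show ?thesis using M by (intro tropically_vanishingI[of M]) auto
    qed
  next
    assume "tropically_vanishing (set xs)"
    then obtain M where M: "M \<in> set xs" "- M \<in> set xs" "\<forall>x\<in>set xs. \<bar>x\<bar> \<le> M"
      unfolding tropically_vanishing_def by blast
    then have "0 \<le> M" by fastforce
    then show "tropically_vanishing (insert 0 (set xs))"
      using M by (intro tropically_vanishingI[of M]) auto
  qed
  then show ?thesis by (simp add: in_rt_sum_iff)
qed

lemma tropically_vanishing_scale:
  assumes "c \<noteq> 0" "tropically_vanishing ((*) c ` X)"
  shows "tropically_vanishing X"
proof -
  obtain M where M: "M \<in> X" "- (c * M) \<in> (*) c ` X" "\<forall>x\<in>X. \<bar>c * x\<bar> \<le> c * M"
    using assms(2) unfolding tropically_vanishing_def by auto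
  then have neg: "- M \<in> X" using assms(1) by (auto simp flip: mult_minus_right)
  have le: "\<bar>x\<bar> \<le> \<bar>M\<bar>" if "x \<in> X" for x
  proof -
    have "\<bar>c\<bar> * \<bar>x\<bar> \<le> \<bar>c\<bar> * \<bar>M\<bar>" using M(3) that by (metis abs_ge_self abs_mult order_trans)
    then show ?thesis using assms(1) by simp
  qed
  show ?thesis
    using M(1) neg le unfolding tropically_vanishing_def
    by (intro bexI[of _ "\<bar>M\<bar>"]) (auto simp: abs_if)
qed

text \<open>The extra \<open>0\<close> in the bound accounts for the terms of a sum in which a determinant vanishes; such
  terms may or may not occur, depending on the dimension.\<close>

lemma tropically_vanishing_two:
  assumes "tropically_vanishing X" "X \<subseteq> {p, q, 0}" "p \<in> X" "q \<in> X"
  shows "p = - q"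
proof -
  obtain M where M: "M \<in> X" "- M \<in> X" "\<forall>x\<in>X. \<bar>x\<bar> \<le> M"
    using assms(1) unfolding tropically_vanishing_def by auto
  then have "\<bar>p\<bar> \<le> M" "\<bar>q\<bar> \<le> M" using assms(3,4) by auto
  moreover have "M \<in> {p, q, 0}" "- M \<in> {p, q, 0}" using M assms(2) by auto
  ultimately show ?thesis by simp (smt (verit))
qed

text \<open>The two inequalities in the definition of a signed seminorm are the relation
  \<open>0 \<in> p \<oplus> (- a) \<oplus> (- b)\<close> of the hyperfield: if \<open>\<bar>p\<bar>\<close> is largest, then \<open>p\<close> equals \<open>a\<close> or \<open>b\<close>; otherwise \<open>a\<close>
  and \<open>b\<close> are opposite with larger absolute value.\<close>

lemma tropically_vanishing_three_between:
  assumes "tropically_vanishing X" "X \<subseteq> {p, - a, - b, 0}" "p \<in> X" "- a \<in> X" "- b \<in> X"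
  shows "min a b \<le> p \<and> p \<le> max a b"
proof -
  obtain M where M: "M \<in> X" "- M \<in> X" "\<forall>x\<in>X. \<bar>x\<bar> \<le> M"
    using assms(1) unfolding tropically_vanishing_def by auto
  then have "\<bar>p\<bar> \<le> M" "\<bar>a\<bar> \<le> M" "\<bar>b\<bar> \<le> M" using assms(3-5) by force+
  moreover have "M \<in> {p, - a, - b, 0}" "- M \<in> {p, - a, - b, 0}" using M assms(2) by auto
  ultimately show ?thesis unfolding min_def max_def by simp (smt (verit))
qed

section \<open>The signed absolute value\<close>

text \<open>The function \<open>sgn(a) \<bar>a\<bar>\<close>. It is multiplicative like the absolute value, but odd, and both the
  homogeneity of seminorms and the universal Grassmann-Pluecker function are expressed by it.\<close>

definition signed_abs :: "('k::linordered_field \<Rightarrow> real) \<Rightarrow> 'k \<Rightarrow> real" where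
  "signed_abs v a = sgn_real a * v a"

context
  fixes v :: "'k::linordered_field \<Rightarrow> real"
  assumes nonarch: "nonarch_absolute_value v"
begin

lemma abs_value_one: "v 1 = 1"
proof -
  have "v (1 * 1) = v 1 * v 1" "v 1 \<noteq> 0"
    using nonarch unfolding nonarch_absolute_value_def by (blast, auto)
  then show ?thesis by simp
qed

lemma signed_abs_0: "signed_abs v 0 = 0"
  by (simp add: signed_abs_def sgn_real_def)

lemma signed_abs_1: "signed_abs v 1 = 1"
  by (simp add: signed_abs_def sgn_real_def abs_value_one)

lemma abs_value_minus_one: "v (- 1) = 1"
proof -
  have "v (- 1 * - 1) = v (- 1) * v (- 1)"
    using nonarch unfolding nonarch_absolute_value_def by blast
  then have "v (- 1) * v (- 1) = 1" by (simp add: abs_value_one)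
  moreover have "0 \<le> v (- 1)" using nonarch unfolding nonarch_absolute_value_def by blast
  ultimately show ?thesis by (auto simp: square_eq_1_iff)
qed

lemma signed_abs_mult: "signed_abs v (a * b) = signed_abs v a * signed_abs v b"
proof -
  have "v (a * b) = v a * v b" using nonarch unfolding nonarch_absolute_value_def by blast
  moreover have "sgn_real (a * b) = sgn_real a * sgn_real b"
    by (cases a "0 :: 'k" rule: linorder_cases; cases b "0 :: 'k" rule: linorder_cases)
      (simp_all add: sgn_real_def zero_less_mult_iff)
  ultimately show ?thesis by (simp add: signed_abs_def)
qed

lemma signed_abs_minus: "signed_abs v (- a) = - signed_abs v a"
  using signed_abs_mult[of "- 1" a] abs_value_minus_one by (simp add: signed_abs_def sgn_real_def)

lemma signed_abs_eq_0_iff: "signed_abs v a = 0 \<longleftrightarrow> a = 0"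
  using nonarch by (auto simp: nonarch_absolute_value_def signed_abs_def sgn_real_def)

lemma signed_abs_sign: "signed_abs v ((- 1) ^ i * a) = (- 1) ^ i * signed_abs v a"
  by (cases "even i") (auto simp: signed_abs_minus)

end

context
  fixes v :: "'k::linordered_field \<Rightarrow> real"
  assumes nonarch: "nonarch_absolute_value v" and compat: "order_compatible v"
begin

lemma signed_abs_mono:
  assumes "a \<le> b"
  shows "signed_abs v a \<le> signed_abs v b"
proof -
  have nonneg: "0 \<le> v c" for c using nonarch unfolding nonarch_absolute_value_def by blast
  have pos: "signed_abs v c \<le> signed_abs v d" if "0 \<le> c" "c \<le> d" for c d
    using that compat nonneg unfolding order_compatible_def signed_abs_def sgn_real_def by auto
  consider "0 \<le> a" | "b \<le> 0" | "a < 0" "0 < b" by linarith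
  then show ?thesis
  proof cases
    case 1
    then show ?thesis using assms by (rule pos)
  next
    case 2
    then have "signed_abs v (- b) \<le> signed_abs v (- a)" using assms by (intro pos) auto
    then show ?thesis by (simp add: signed_abs_minus[OF nonarch])
  next
    case 3
    then show ?thesis using nonneg[of a] nonneg[of b]
      by (simp add: signed_abs_def sgn_real_def)
  qed
qed

text \<open>Compatibility with the ordering gives \<open>\<bar>1\<bar> \<le> \<bar>2\<bar>\<close>, and the ultrametric inequality gives \<open>\<bar>2\<bar> \<le> \<bar>1\<bar>\<close>.\<close>

lemma signed_abs_double: "signed_abs v (a + a) = signed_abs v a"
proof -
  have "v (1 + 1) \<le> max (v 1) (v 1)"
    using nonarch unfolding nonarch_absolute_value_def by blast
  moreover have "v 1 \<le> v (1 + 1)" using compat unfolding order_compatible_def by simp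
  ultimately have "v (1 + 1) = 1" by (simp add: abs_value_one[OF nonarch])
  then have "signed_abs v (1 + 1) = 1" by (simp add: signed_abs_def sgn_real_def)
  then show ?thesis using signed_abs_mult[OF nonarch, of "1 + 1" a] by (simp add: algebra_simps)
qed

text \<open>The signed absolute value is itself a signed seminorm on \<open>K\<close>. If \<open>a \<le> b\<close>, then
  \<open>2 a \<le> a + b \<le> 2 b\<close>, and the signed absolute value is monotone and ignores the factor \<open>2\<close>.\<close>

lemma signed_abs_add_between:
  "min (signed_abs v a) (signed_abs v b) \<le> signed_abs v (a + b)
    \<and> signed_abs v (a + b) \<le> max (signed_abs v a) (signed_abs v b)"
proof (cases "a \<le> b")
  case True
  then have "a + a \<le> a + b" "a + b \<le> b + b" by auto
  from this[THEN signed_abs_mono] show ?thesis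
    unfolding signed_abs_double by auto
next
  case False
  then have "b + b \<le> a + b" "a + b \<le> a + a" by auto
  from this[THEN signed_abs_mono] show ?thesis
    unfolding signed_abs_double by auto
qed

end

section \<open>Linear algebra of functionals\<close>

text \<open>The linear algebra is done in an arbitrary dimension; \<open>std_dual n\<close> is the case \<open>m = n + 1\<close>.\<close>

abbreviation vec_dual :: "nat \<Rightarrow> ('k::field, 'k vec \<Rightarrow> 'k) module" where
  "vec_dual m \<equiv> dual_space (module_vec TYPE('k) m)"

lemma vec_dual_iff:
  "f \<in> carrier (vec_dual m) \<longleftrightarrow> f \<in> carrier_vec m \<rightarrow>\<^sub>E UNIV \<and>
     (\<forall>x\<in>carrier_vec m. \<forall>y\<in>carrier_vec m. f (x + y) = f x + f y) \<and>
     (\<forall>c. \<forall>x\<in>carrier_vec m. f (c \<cdot>\<^sub>v x) = c * f x)"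
  by (simp add: dual_space_def module_vec_simps)

lemma vec_dual_ops:
  "f \<oplus>\<^bsub>vec_dual m\<^esub> g = (\<lambda>x\<in>carrier_vec m. f x + g x)"
  "c \<odot>\<^bsub>vec_dual m\<^esub> f = (\<lambda>x\<in>carrier_vec m. c * f x)"
  by (simp_all add: dual_space_def module_vec_simps)

lemma vec_dual_add:
  "f \<in> carrier (vec_dual m) \<Longrightarrow> x \<in> carrier_vec m \<Longrightarrow> y \<in> carrier_vec m \<Longrightarrow> f (x + y) = f x + f y"
  unfolding vec_dual_iff by blast

lemma vec_dual_scale:
  "f \<in> carrier (vec_dual m) \<Longrightarrow> x \<in> carrier_vec m \<Longrightarrow> f (c \<cdot>\<^sub>v x) = c * f x"
  unfolding vec_dual_iff by blast

lemma vec_dual_eqI: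
  assumes "f \<in> carrier (vec_dual m)" "g \<in> carrier (vec_dual m)"
    and "\<And>x. x \<in> carrier_vec m \<Longrightarrow> f x = g x"
  shows "f = g"
proof -
  have "f \<in> carrier_vec m \<rightarrow>\<^sub>E UNIV" "g \<in> carrier_vec m \<rightarrow>\<^sub>E UNIV"
    using assms(1,2) unfolding vec_dual_iff by blast+
  then show ?thesis using assms(3) by (rule PiE_ext)
qed

lemma vec_dual_sum_closed:
  assumes "\<And>j. j \<in> J \<Longrightarrow> h j \<in> carrier (vec_dual m)"
  shows "(\<lambda>x\<in>carrier_vec m. \<Sum>j\<in>J. h j x) \<in> carrier (vec_dual m)"
proof -
  have "(\<Sum>j\<in>J. h j (x + y)) = (\<Sum>j\<in>J. h j x) + (\<Sum>j\<in>J. h j y)"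
    if "x \<in> carrier_vec m" "y \<in> carrier_vec m" for x y
    unfolding sum.distrib[symmetric]
    by (rule sum.cong[OF refl]) (rule vec_dual_add[OF assms that])
  moreover have "(\<Sum>j\<in>J. h j (c \<cdot>\<^sub>v x)) = c * (\<Sum>j\<in>J. h j x)" if "x \<in> carrier_vec m" for c x
    unfolding sum_distrib_left
    by (rule sum.cong[OF refl]) (rule vec_dual_scale[OF assms that])
  ultimately show ?thesis unfolding vec_dual_iff by simp
qed

lemma vec_dual_scale_closed:
  assumes "f \<in> carrier (vec_dual m)"
  shows "c \<odot>\<^bsub>vec_dual m\<^esub> f \<in> carrier (vec_dual m)"
proof -
  have "c * f (x + y) = c * f x + c * f y" if "x \<in> carrier_vec m" "y \<in> carrier_vec m" for x y
    unfolding vec_dual_add[OF assms that] by (rule distrib_left)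
  moreover have "c * f (d \<cdot>\<^sub>v x) = d * (c * f x)" if "x \<in> carrier_vec m" for d x
    unfolding vec_dual_scale[OF assms that] by (rule mult.left_commute)
  ultimately show ?thesis unfolding vec_dual_iff vec_dual_ops by simp
qed

lemma vec_dual_add_closed:
  assumes "f \<in> carrier (vec_dual m)" "g \<in> carrier (vec_dual m)"
  shows "f \<oplus>\<^bsub>vec_dual m\<^esub> g \<in> carrier (vec_dual m)"
proof -
  have "f (x + y) + g (x + y) = f x + g x + (f y + g y)"
    if "x \<in> carrier_vec m" "y \<in> carrier_vec m" for x y
    unfolding vec_dual_add[OF assms(1) that] vec_dual_add[OF assms(2) that] by simp
  moreover have "f (d \<cdot>\<^sub>v x) + g (d \<cdot>\<^sub>v x) = d * (f x + g x)" if "x \<in> carrier_vec m" for d x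
    unfolding vec_dual_scale[OF assms(1) that] vec_dual_scale[OF assms(2) that]
    by (rule distrib_left[symmetric])
  ultimately show ?thesis unfolding vec_dual_iff vec_dual_ops by simp
qed

definition coordinate :: "nat \<Rightarrow> nat \<Rightarrow> 'k::field vec \<Rightarrow> 'k" where
  "coordinate m i = (\<lambda>x\<in>carrier_vec m. x $ i)"

lemma coordinate_in_vec_dual:
  assumes "i < m"
  shows "coordinate m i \<in> carrier (vec_dual m)"
  using assms by (simp add: coordinate_def vec_dual_iff)

lemma vec_dual_expansion:
  assumes f: "f \<in> carrier (vec_dual m)" and x: "x \<in> carrier_vec m"
  shows "f x = (\<Sum>k<m. x $ k * f (unit_vec m k))"
proof -
  have "f (vec m (\<lambda>k. if k < l then x $ k else 0)) = (\<Sum>k<l. x $ k * f (unit_vec m k))"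
    if "l \<le> m" for l
    using that
  proof (induction l)
    case 0
    have "vec m (\<lambda>k. if k < 0 then x $ k else 0) = 0 \<cdot>\<^sub>v 0\<^sub>v m"
      by (intro eq_vecI) auto
    then show ?case by (simp add: vec_dual_scale[OF f])
  next
    case (Suc l)
    let ?t = "\<lambda>l. vec m (\<lambda>k. if k < l then x $ k else 0)"
    have "?t (Suc l) = ?t l + x $ l \<cdot>\<^sub>v unit_vec m l"
      using Suc.prems by (intro eq_vecI) (auto simp: less_Suc_eq)
    then have "f (?t (Suc l)) = f (?t l) + x $ l * f (unit_vec m l)"
      by (simp add: vec_dual_add[OF f] vec_dual_scale[OF f])
    then show ?case using Suc by simp
  qed
  from this[of m] have
    "f (vec m (\<lambda>k. if k < m then x $ k else 0)) = (\<Sum>k<m. x $ k * f (unit_vec m k))"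
    by simp
  moreover have "vec m (\<lambda>k. if k < m then x $ k else 0) = x"
    using x by (intro eq_vecI) auto
  ultimately show ?thesis by simp
qed

definition functional_mat :: "nat \<Rightarrow> ('k::field vec \<Rightarrow> 'k) list \<Rightarrow> 'k mat" where
  "functional_mat m fs = mat m m (\<lambda>(i, j). (fs ! j) (unit_vec m i))"

lemma functional_mat_carrier: "functional_mat m fs \<in> carrier_mat m m"
  by (simp add: functional_mat_def)

definition family_det :: "nat \<Rightarrow> ('k::field vec \<Rightarrow> 'k) list \<Rightarrow> 'k" where
  "family_det m fs = Determinant.det (functional_mat m fs)"

lemma functional_det_eq: "functional_det n fs = family_det (n + 1) fs"
  by (simp add: functional_det_def family_det_def functional_mat_def)

text \<open>A linear relation among the functionals is a vector in the kernel of their matrix.\<close>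

lemma independent_if_family_det_nonzero:
  assumes "family_det m fs \<noteq> 0"
    and "\<And>x. x \<in> carrier_vec m \<Longrightarrow> (\<Sum>j<m. c j * (fs ! j) x) = 0"
    and "j < m"
  shows "c j = 0"
proof -
  let ?c = "vec m c"
  have "functional_mat m fs *\<^sub>v ?c = 0\<^sub>v m"
  proof (rule eq_vecI)
    fix i assume "i < dim_vec (0\<^sub>v m)"
    then have i: "i < m" by simp
    then have "(functional_mat m fs *\<^sub>v ?c) $ i = (\<Sum>j<m. c j * (fs ! j) (unit_vec m i))"
      by (simp add: functional_mat_def scalar_prod_def atLeast0LessThan mult.commute)
    then show "(functional_mat m fs *\<^sub>v ?c) $ i = 0\<^sub>v m $ i" using assms(2) i by simp
  qed (simp add: functional_mat_def)
  then have "?c = 0\<^sub>v m"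
    using assms(1) det_0_iff_vec_prod_zero[OF functional_mat_carrier, of m fs]
    unfolding family_det_def using vec_carrier[of m c] by blast
  then have "?c $ j = 0\<^sub>v m $ j" by simp
  then show ?thesis using assms(3) by simp
qed

text \<open>A nonzero common zero of the functionals is a vector in the kernel of the transposed matrix. In this form
  the invertibility of a matrix does not depend on the order of its columns.\<close>

lemma family_det_nonzero_if_no_common_zero:
  assumes fs: "length fs = m" "set fs \<subseteq> carrier (vec_dual m)"
    and no_zero: "\<And>x. x \<in> carrier_vec m \<Longrightarrow> \<forall>f\<in>set fs. f x = 0 \<Longrightarrow> x = 0\<^sub>v m"
  shows "family_det m fs \<noteq> 0"
proof
  let ?B = "transpose_mat (functional_mat m fs)"
  have B: "?B \<in> carrier_mat m m" using functional_mat_carrier by simp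
  assume "family_det m fs = 0"
  then have "Determinant.det ?B = 0"
    by (simp add: family_det_def Determinant.det_transpose[OF functional_mat_carrier])
  then obtain x where x: "x \<in> carrier_vec m" "x \<noteq> 0\<^sub>v m" "?B *\<^sub>v x = 0\<^sub>v m"
    using det_0_iff_vec_prod_zero[OF B] by auto
  have "f x = 0" if "f \<in> set fs" for f
  proof -
    obtain j where "j < length fs" "fs ! j = f" using \<open>f \<in> set fs\<close> by (meson in_set_conv_nth)
    then have j: "j < m" "f = fs ! j" using fs(1) by simp_all
    have "(?B *\<^sub>v x) $ j = (\<Sum>k<m. x $ k * f (unit_vec m k))"
      using j x(1) by (simp add: functional_mat_def scalar_prod_def atLeast0LessThan mult.commute)
    then have "f x = (?B *\<^sub>v x) $ j"
      using vec_dual_expansion[of f m x] fs(2) that x(1) by (simp add: subset_iff)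
    then show ?thesis using x(3) j by simp
  qed
  then show False using no_zero x(1,2) by blast
qed

text \<open>Placing the row \<open>(f\<^sub>0(x), \<dots>, f\<^sub>m(x))\<close> on top of the \<open>m\<close> rows of coordinates gives a square matrix
  whose top row is a linear combination of the others, with the coordinates of \<open>x\<close> as coefficients.
  The relation is the expansion of its determinant along the top row.\<close>

lemma cramer_relation:
  assumes C: "length C = Suc m" "set C \<subseteq> carrier (vec_dual m)" and x: "x \<in> carrier_vec m"
  shows "(\<Sum>i<Suc m. (- 1) ^ i * family_det m (take i C @ drop (Suc i) C) * (C ! i) x) = 0"
proof -
  define A where "A = mat (Suc m) (Suc m)
    (\<lambda>(i, j). (C ! j) (if i = 0 then x else unit_vec m (i - 1)))"
  have A: "A \<in> carrier_mat (Suc m) (Suc m)" by (simp add: A_def)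
  \<comment> \<open>The coefficients of the linear dependency among the rows: the top row minus its expansion.\<close>
  define w where "w = vec (Suc m) (\<lambda>i. if i = 0 then 1 else - x $ (i - 1))"
  have "transpose_mat A *\<^sub>v w = 0\<^sub>v (Suc m)"
  proof (rule eq_vecI)
    fix j assume "j < dim_vec (0\<^sub>v (Suc m))"
    then have j: "j < Suc m" by simp
    then have Cj: "C ! j \<in> carrier (vec_dual m)" using C by auto
    have "(transpose_mat A *\<^sub>v w) $ j = (\<Sum>i<Suc m. A $$ (i, j) * w $ i)"
      using j by (simp add: A_def w_def scalar_prod_def atLeast0LessThan)
    also have "\<dots> = (C ! j) x - (\<Sum>k<m. x $ k * (C ! j) (unit_vec m k))"
      using j by (simp add: A_def w_def sum.lessThan_Suc_shift sum_negf mult.commute del: sum.lessThan_Suc)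
    finally show "(transpose_mat A *\<^sub>v w) $ j = 0\<^sub>v (Suc m) $ j"
      using j vec_dual_expansion[OF Cj x] by simp
  qed (simp add: A_def)
  moreover have "w \<in> carrier_vec (Suc m)" by (simp add: w_def)
  moreover have "w \<noteq> 0\<^sub>v (Suc m)"
  proof
    assume "w = 0\<^sub>v (Suc m)"
    then have "w $ 0 = 0\<^sub>v (Suc m) $ 0" by simp
    then show False by (simp add: w_def)
  qed
  moreover have "transpose_mat A \<in> carrier_mat (Suc m) (Suc m)" using A by simp
  ultimately have "Determinant.det (transpose_mat A) = 0"
    using det_0_iff_vec_prod_zero by blast
  then have "Determinant.det A = 0" using Determinant.det_transpose[OF A] by simp
  moreover have "mat_delete A 0 j = functional_mat m (take j C @ drop (Suc j) C)" if "j < Suc m" for j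
    using that C(1)
    by (intro eq_matI) (auto simp: mat_delete_def A_def functional_mat_def nth_append min_def)
  then have "Determinant.det A =
      (\<Sum>j<Suc m. (C ! j) x * ((- 1) ^ j * family_det m (take j C @ drop (Suc j) C)))"
    using laplace_expansion_row[OF A, of 0]
    by (simp add: A_def cofactor_def family_det_def del: sum.lessThan_Suc)
  ultimately show ?thesis by (simp add: ac_simps del: sum.lessThan_Suc)
qed

text \<open>A family is completed to a basis by the coordinate functionals outside \<open>I\<close>; this works if zero is
  the only vector supported on \<open>I\<close> at which the whole family vanishes.\<close>

lemma unit_completion_nonzero:
  assumes fs: "set fs \<subseteq> carrier (vec_dual m)" and I: "I \<subseteq> {..<m}" "card I = length fs"
    and no_zero: "\<And>x. x \<in> carrier_vec m \<Longrightarrow> \<forall>k<m. k \<notin> I \<longrightarrow> x $ k = 0 \<Longrightarrow>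
      \<forall>f\<in>set fs. f x = 0 \<Longrightarrow> x = 0\<^sub>v m"
  shows "\<exists>hs. length (fs @ hs) = m \<and> set (fs @ hs) \<subseteq> carrier (vec_dual m)
    \<and> family_det m (fs @ hs) \<noteq> 0"
proof -
  define hs :: "('a vec \<Rightarrow> 'a) list" where
    "hs = map (coordinate m) (sorted_list_of_set ({..<m} - I))"
  have set_hs: "set hs = coordinate m ` ({..<m} - I)" by (simp add: hs_def)
  have "length hs = card ({..<m} - I)" by (simp add: hs_def)
  also have "\<dots> = m - length fs"
    using I finite_subset[OF I(1)] by (simp add: card_Diff_subset)
  finally have len: "length (fs @ hs) = m"
    using card_mono[OF finite_lessThan I(1)] I(2) by simp
  moreover have sub: "set (fs @ hs) \<subseteq> carrier (vec_dual m)"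
    using fs coordinate_in_vec_dual by (auto simp: set_hs)
  moreover have "family_det m (fs @ hs) \<noteq> 0"
  proof (rule family_det_nonzero_if_no_common_zero[OF len sub])
    fix x :: "'a vec" assume x: "x \<in> carrier_vec m" "\<forall>f\<in>set (fs @ hs). f x = 0"
    then have "x $ k = 0" if "k < m" "k \<notin> I" for k
    proof -
      have "coordinate m k x = 0" using that x(2) by (simp add: set_hs ball_Un)
      then show ?thesis using x(1) by (simp add: coordinate_def)
    qed
    then show "x = 0\<^sub>v m" using no_zero x by auto
  qed
  ultimately show ?thesis by blast
qed

lemma complete_nonzero_functional:
  assumes f: "f \<in> carrier (vec_dual m)" and i: "i < m" "f (unit_vec m i) \<noteq> 0"
  shows "\<exists>hs. length (f # hs) = m \<and> set (f # hs) \<subseteq> carrier (vec_dual m)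
    \<and> family_det m (f # hs) \<noteq> 0"
proof -
  have "x = 0\<^sub>v m" if x: "x \<in> carrier_vec m" "\<forall>k<m. k \<notin> {i} \<longrightarrow> x $ k = 0" "f x = 0" for x
  proof -
    have "f x = (\<Sum>k\<in>{i}. x $ k * f (unit_vec m k))"
      unfolding vec_dual_expansion[OF f x(1)]
      by (rule sum.mono_neutral_right) (use i x(2) in auto)
    then have "x $ i = 0" using i x(3) by simp
    then show ?thesis using x(1,2) by (intro eq_vecI) auto
  qed
  note zero = this
  have "\<exists>hs. length ([f] @ hs) = m \<and> set ([f] @ hs) \<subseteq> carrier (vec_dual m)
      \<and> family_det m ([f] @ hs) \<noteq> 0"
  proof (rule unit_completion_nonzero)
    show "set [f] \<subseteq> carrier (vec_dual m)" "{i} \<subseteq> {..<m}" "card {i} = length [f]"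
      using f i by simp_all
  qed (use zero in simp)
  then show ?thesis by simp
qed

text \<open>Two functionals with a nonzero minor in the coordinates \<open>i, j\<close> do not both vanish at a nonzero
  vector supported on these coordinates, by Cramer's rule for two unknowns.\<close>

lemma complete_independent_pair:
  assumes f: "f \<in> carrier (vec_dual m)" and g: "g \<in> carrier (vec_dual m)"
    and i: "i < m" and j: "j < m"
    and minor: "f (unit_vec m i) * g (unit_vec m j)
      \<noteq> f (unit_vec m j) * g (unit_vec m i)"
  shows "\<exists>hs. length (f # g # hs) = m \<and> set (f # g # hs) \<subseteq> carrier (vec_dual m)
    \<and> family_det m (f # g # hs) \<noteq> 0"
proof -
  have "i \<noteq> j" using minor by auto
  let ?u = "unit_vec m"
  have "x = 0\<^sub>v m"
    if x: "x \<in> carrier_vec m" "\<forall>k<m. k \<notin> {i, j} \<longrightarrow> x $ k = 0" "f x = 0" "g x = 0" for x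
  proof -
    have two: "h x = x $ i * h (?u i) + x $ j * h (?u j)" if "h \<in> carrier (vec_dual m)" for h
    proof -
      have "h x = (\<Sum>k\<in>{i, j}. x $ k * h (?u k))"
        unfolding vec_dual_expansion[OF that x(1)]
        by (rule sum.mono_neutral_right) (use i j x(2) in auto)
      then show ?thesis using \<open>i \<noteq> j\<close> by simp
    qed
    have fx: "x $ i * f (?u i) + x $ j * f (?u j) = 0" and gx: "x $ i * g (?u i) + x $ j * g (?u j) = 0"
      using two f g x(3,4) by auto
    let ?D = "f (?u i) * g (?u j) - f (?u j) * g (?u i)"
    have "x $ i * ?D = (x $ i * f (?u i) + x $ j * f (?u j)) * g (?u j)
        - (x $ i * g (?u i) + x $ j * g (?u j)) * f (?u j)" by (simp add: algebra_simps)
    moreover have "x $ j * ?D = (x $ i * g (?u i) + x $ j * g (?u j)) * f (?u i)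
        - (x $ i * f (?u i) + x $ j * f (?u j)) * g (?u i)" by (simp add: algebra_simps)
    ultimately have "x $ i = 0" "x $ j = 0" using fx gx minor by auto
    then show ?thesis using x(1,2) by (intro eq_vecI) auto
  qed
  note zero = this
  have "\<exists>hs. length ([f, g] @ hs) = m \<and> set ([f, g] @ hs) \<subseteq> carrier (vec_dual m)
      \<and> family_det m ([f, g] @ hs) \<noteq> 0"
  proof (rule unit_completion_nonzero)
    show "set [f, g] \<subseteq> carrier (vec_dual m)" "{i, j} \<subseteq> {..<m}" "card {i, j} = length [f, g]"
      using f g i j \<open>i \<noteq> j\<close> by simp_all
  qed (use zero in simp)
  then show ?thesis by simp
qed

text \<open>Cramer's relation for \<open>f\<close> followed by the basis expresses \<open>det(b) f\<close> by the basis, and so does the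
  given expansion. The coefficients with respect to a basis are unique.\<close>

lemma deleted_minors_of_expansion:
  assumes bs: "length bs = m" "set bs \<subseteq> carrier (vec_dual m)" "family_det m bs \<noteq> 0"
    and f: "f \<in> carrier (vec_dual m)" and j: "j < m"
    and expansion: "\<And>x. x \<in> carrier_vec m \<Longrightarrow> f x = (\<Sum>j<m. a j * (bs ! j) x)"
  shows "family_det m (f # take j bs @ drop (Suc j) bs) = (- 1) ^ j * a j * family_det m bs"
proof -
  define d where "d j = family_det m (f # take j bs @ drop (Suc j) bs)" for j
  let ?d = "family_det m bs"
  have "(\<Sum>j<m. (?d * a j - (- 1) ^ j * d j) * (bs ! j) x) = 0" if x: "x \<in> carrier_vec m" for x
  proof -
    have "(\<Sum>i<Suc m. (- 1) ^ i * family_det m (take i (f # bs) @ drop (Suc i) (f # bs)) * ((f # bs) ! i) x) = 0"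
      by (rule cramer_relation) (use bs f x in simp_all)
    then have "?d * f x + (\<Sum>j<m. - ((- 1) ^ j * d j * (bs ! j) x)) = 0"
      by (simp add: sum.lessThan_Suc_shift d_def del: sum.lessThan_Suc)
    moreover have "?d * f x = (\<Sum>j<m. ?d * a j * (bs ! j) x)"
      unfolding expansion[OF x] sum_distrib_left by (simp add: mult.assoc)
    ultimately show ?thesis
      by (simp add: left_diff_distrib sum_subtractf sum_negf)
  qed
  from independent_if_family_det_nonzero[OF bs(3) this j]
  have eq: "(- 1) ^ j * d j = ?d * a j" by simp
  have "(- 1) ^ j * (- 1) ^ j = (1 :: 'a)" by (simp flip: power_mult_distrib)
  then have "d j = (- 1) ^ j * ((- 1) ^ j * d j)" by (simp flip: mult.assoc)
  then have "d j = (- 1) ^ j * a j * ?d" unfolding eq by (simp add: mult_ac)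
  then show ?thesis unfolding d_def .
qed

section \<open>Signed seminorms and linear relations\<close>

lemma seminorm_scale:
  assumes "signed_seminorm v (vec_dual m) N" "f \<in> carrier (vec_dual m)"
  shows "N (c \<odot>\<^bsub>vec_dual m\<^esub> f) = signed_abs v c * N f"
  using assms unfolding signed_seminorm_def signed_abs_def by blast

lemma seminorm_add_between:
  assumes "signed_seminorm v (vec_dual m) N" "f \<in> carrier (vec_dual m)" "g \<in> carrier (vec_dual m)"
  shows "min (N f) (N g) \<le> N (f \<oplus>\<^bsub>vec_dual m\<^esub> g)" "N (f \<oplus>\<^bsub>vec_dual m\<^esub> g) \<le> max (N f) (N g)"
  using assms unfolding signed_seminorm_def by blast+

lemma seminorm_of_zero:
  assumes "signed_seminorm v (vec_dual m) N"
  shows "N (\<lambda>x\<in>carrier_vec m. 0) = 0"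
proof -
  let ?z = "(\<lambda>x\<in>carrier_vec m. 0) :: 'a vec \<Rightarrow> 'a"
  have z: "?z \<in> carrier (vec_dual m)" using vec_dual_sum_closed[of "{}"] by simp
  have "0 \<odot>\<^bsub>vec_dual m\<^esub> ?z = ?z" by (simp add: vec_dual_ops restrict_def cong: if_cong)
  then show ?thesis
    using seminorm_scale[OF assms z, of 0] by (simp add: signed_abs_def sgn_real_def)
qed

text \<open>A negative factor exchanges the roles of the minimum and the maximum. Constants \<open>c < 0\<close> are needed to
  reverse signs in \<open>seminorm_of_relation_vanishes\<close> and because homotheties may be negative.\<close>

lemma homothetic_seminorm:
  assumes N: "signed_seminorm v (vec_dual m) N"
  shows "signed_seminorm v (vec_dual m) (\<lambda>f\<in>carrier (vec_dual m). c * N f)"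
  unfolding signed_seminorm_def
proof (intro conjI allI ballI)
  let ?E = "carrier (vec_dual m) :: ('a vec \<Rightarrow> 'a) set"
  fix f assume f: "f \<in> ?E"
  show "(\<lambda>f\<in>?E. c * N f) (a \<odot>\<^bsub>vec_dual m\<^esub> f) = sgn_real a * v a * (\<lambda>f\<in>?E. c * N f) f" for a
    using f vec_dual_scale_closed[OF f, of a] seminorm_scale[OF N f, of a] by (simp add: signed_abs_def)
  fix g assume g: "g \<in> ?E"
  note between = seminorm_add_between[OF N f g]
  have "min (c * N f) (c * N g) \<le> c * N (f \<oplus>\<^bsub>vec_dual m\<^esub> g)
      \<and> c * N (f \<oplus>\<^bsub>vec_dual m\<^esub> g) \<le> max (c * N f) (c * N g)"
  proof (cases "0 \<le> c")
    case True
    then show ?thesis using mult_left_mono[OF between(1)] mult_left_mono[OF between(2)]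
      by (simp add: min_mult_distrib_left max_mult_distrib_left)
  next
    case False
    then show ?thesis
      using mult_left_mono_neg[OF between(1), of c] mult_left_mono_neg[OF between(2), of c]
      by (simp add: min_mult_distrib_left max_mult_distrib_left)
  qed
  then show "min ((\<lambda>f\<in>?E. c * N f) f) ((\<lambda>f\<in>?E. c * N f) g) \<le> (\<lambda>f\<in>?E. c * N f) (f \<oplus>\<^bsub>vec_dual m\<^esub> g)"
    "(\<lambda>f\<in>?E. c * N f) (f \<oplus>\<^bsub>vec_dual m\<^esub> g) \<le> max ((\<lambda>f\<in>?E. c * N f) f) ((\<lambda>f\<in>?E. c * N f) g)"
    using f g vec_dual_add_closed[OF f g] by simp_all
qed simp

text \<open>By the lower inequality in the definition of a signed seminorm, the functionals of value above
  \<open>- M\<close> are closed under addition; the empty sum is among them because \<open>0 < M\<close>.\<close>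

lemma seminorm_sum_gt:
  assumes N: "signed_seminorm v (vec_dual m) N" and "finite J" "0 < M"
    and "\<And>j. j \<in> J \<Longrightarrow> h j \<in> carrier (vec_dual m)" "\<And>j. j \<in> J \<Longrightarrow> - M < N (h j)"
  shows "- M < N (\<lambda>x\<in>carrier_vec m. \<Sum>j\<in>J. h j x)"
  using assms(2,4,5)
proof (induction J rule: finite_induct)
  case empty
  show ?case unfolding sum.empty using seminorm_of_zero[OF N] \<open>0 < M\<close> by linarith
next
  case (insert i J)
  let ?s = "\<lambda>x\<in>carrier_vec m. \<Sum>j\<in>J. h j x"
  have "?s \<in> carrier (vec_dual m)" using insert.prems(1) by (intro vec_dual_sum_closed) simp
  moreover have "h i \<in> carrier (vec_dual m)" using insert.prems(1) by simp
  ultimately have "min (N (h i)) (N ?s) \<le> N (h i \<oplus>\<^bsub>vec_dual m\<^esub> ?s)"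
    using seminorm_add_between(1)[OF N] by blast
  moreover have "- M < N ?s" by (rule insert.IH) (use insert.prems in blast)+
  moreover have "- M < N (h i)" using insert.prems(2) by blast
  ultimately have "- M < N (h i \<oplus>\<^bsub>vec_dual m\<^esub> ?s)" by linarith
  moreover have "h i \<oplus>\<^bsub>vec_dual m\<^esub> ?s = (\<lambda>x\<in>carrier_vec m. \<Sum>j\<in>insert i J. h j x)"
    unfolding vec_dual_ops by (rule restrict_ext) (use insert.hyps in simp)
  ultimately show ?case by (simp only:)
qed

text \<open>Otherwise the sum of the other terms has value above \<open>- N(h\<^sub>i)\<close>; but that sum is \<open>- h\<^sub>i\<close>.\<close>

lemma seminorm_opposite_term:
  assumes nonarch: "nonarch_absolute_value v" and N: "signed_seminorm v (vec_dual m) N"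
    and J: "finite J" "i \<in> J" and h: "\<And>j. j \<in> J \<Longrightarrow> h j \<in> carrier (vec_dual m)"
    and sum_zero: "\<And>x. x \<in> carrier_vec m \<Longrightarrow> (\<Sum>j\<in>J. h j x) = 0" and pos: "0 < N (h i)"
  shows "\<exists>j\<in>J. N (h j) \<le> - N (h i)"
proof (rule ccontr)
  assume "\<not> ?thesis"
  then have "- N (h i) < N (\<lambda>x\<in>carrier_vec m. \<Sum>j\<in>J - {i}. h j x)"
    using J(1) h by (intro seminorm_sum_gt[OF N _ pos]) (auto simp: not_le)
  also have "(\<lambda>x\<in>carrier_vec m. \<Sum>j\<in>J - {i}. h j x) = - 1 \<odot>\<^bsub>vec_dual m\<^esub> h i"
    unfolding vec_dual_ops
  proof (rule restrict_ext)
    fix x :: "'a vec" assume "x \<in> carrier_vec m"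
    then show "(\<Sum>j\<in>J - {i}. h j x) = - 1 * h i x"
      using sum_zero[of x] sum.remove[OF J, of "\<lambda>j. h j x"] by (simp add: eq_neg_iff_add_eq_0 add.commute)
  qed
  also have "N \<dots> = - N (h i)"
    by (simp add: seminorm_scale[OF N h[OF J(2)]] signed_abs_minus[OF nonarch] signed_abs_1[OF nonarch])
  finally show False by simp
qed

text \<open>The value of largest absolute value among the terms of a relation is attained with both signs: apply
  the preceding lemma to \<open>N\<close> or to \<open>- N\<close>, according to the sign of that value.\<close>

lemma seminorm_of_relation_vanishes:
  assumes nonarch: "nonarch_absolute_value v" and N: "signed_seminorm v (vec_dual m) N"
    and J: "finite J" "J \<noteq> {}" and g: "\<And>j. j \<in> J \<Longrightarrow> g j \<in> carrier (vec_dual m)"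
    and relation: "\<And>x. x \<in> carrier_vec m \<Longrightarrow> (\<Sum>j\<in>J. c j * g j x) = 0"
  shows "tropically_vanishing ((\<lambda>j. signed_abs v (c j) * N (g j)) ` J)"
proof -
  define h where "h j = c j \<odot>\<^bsub>vec_dual m\<^esub> g j" for j
  have h: "h j \<in> carrier (vec_dual m)" if "j \<in> J" for j
    unfolding h_def by (rule vec_dual_scale_closed[OF g[OF that]])
  have sum_zero: "(\<Sum>j\<in>J. h j x) = 0" if "x \<in> carrier_vec m" for x
    using relation[OF that] that by (simp add: h_def vec_dual_ops)
  have "Max ((\<lambda>j. \<bar>N (h j)\<bar>) ` J) \<in> (\<lambda>j. \<bar>N (h j)\<bar>) ` J" using J by (intro Max_in) auto
  then obtain i where i: "i \<in> J" "Max ((\<lambda>j. \<bar>N (h j)\<bar>) ` J) = \<bar>N (h i)\<bar>" by blast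
  have le: "\<bar>N (h j)\<bar> \<le> \<bar>N (h i)\<bar>" if "j \<in> J" for j
    unfolding i(2)[symmetric] using J(1) that by (intro Max_ge) auto
  have "\<exists>j\<in>J. N (h j) = - N (h i)"
  proof (cases "N (h i)" "0 :: real" rule: linorder_cases)
    case less
    let ?N = "\<lambda>f\<in>carrier (vec_dual m). - 1 * N f"
    have "\<exists>j\<in>J. ?N (h j) \<le> - ?N (h i)"
      by (rule seminorm_opposite_term[OF nonarch homothetic_seminorm[OF N] J(1) i(1) h sum_zero])
        (use less h i(1) in simp_all)
    then obtain j where "j \<in> J" "- N (h i) \<le> N (h j)" using h i(1) by auto
    then show ?thesis using le[of j] less by (intro bexI[of _ j]) linarith+
  next
    case equal
    then show ?thesis using i(1) by auto
  next
    case greater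
    then obtain j where "j \<in> J" "N (h j) \<le> - N (h i)"
      using seminorm_opposite_term[OF nonarch N J(1) i(1) h sum_zero] by blast
    then show ?thesis using le[of j] greater by (intro bexI[of _ j]) linarith+
  qed
  then obtain j where j: "j \<in> J" "N (h j) = - N (h i)" by blast
  have "tropically_vanishing ((\<lambda>j. N (h j)) ` J)"
  proof (rule tropically_vanishingI[of "\<bar>N (h i)\<bar>"])
    have mem: "N (h i) \<in> (\<lambda>j. N (h j)) ` J" "- N (h i) \<in> (\<lambda>j. N (h j)) ` J"
      using i(1) j by (auto intro: rev_image_eqI)
    then show "\<bar>N (h i)\<bar> \<in> (\<lambda>j. N (h j)) ` J" "- \<bar>N (h i)\<bar> \<in> (\<lambda>j. N (h j)) ` J"
      by (cases "0 \<le> N (h i)"; simp)+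
    show "\<bar>x\<bar> \<le> \<bar>N (h i)\<bar>" if "x \<in> (\<lambda>j. N (h j)) ` J" for x using that le by blast
  qed
  also have "(\<lambda>j. N (h j)) ` J = (\<lambda>j. signed_abs v (c j) * N (g j)) ` J"
    unfolding h_def by (rule image_cong[OF refl]) (rule seminorm_scale[OF N g])
  finally show ?thesis .
qed

section \<open>The circuit condition\<close>

text \<open>The defining condition of the tropical linear space on a representative \<open>y\<close>, in dimension \<open>m\<close>. A
  tuple that spans the dual space contributes its circuit in the universal matroid; for the other
  tuples all determinants vanish and the condition is void.\<close>

definition circuit_condition ::
    "('k::linordered_field \<Rightarrow> real) \<Rightarrow> nat \<Rightarrow> (('k vec \<Rightarrow> 'k) \<Rightarrow> real) \<Rightarrow> bool" where
  "circuit_condition v m y \<longleftrightarrow>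
     (\<forall>C. length C = Suc m \<and> set C \<subseteq> carrier (vec_dual m) \<longrightarrow>
       tropically_vanishing
         ((\<lambda>i. (- 1) ^ i * y (C ! i) * signed_abs v (family_det m (take i C @ drop (Suc i) C))) ` {..<Suc m}))"

lemma circuit_condition_of_seminorm:
  assumes nonarch: "nonarch_absolute_value v" and N: "signed_seminorm v (vec_dual m) N"
  shows "circuit_condition v m N"
  unfolding circuit_condition_def
proof (intro allI impI, elim conjE)
  fix C :: "('a vec \<Rightarrow> 'a) list" assume C: "length C = Suc m" "set C \<subseteq> carrier (vec_dual m)"
  let ?d = "\<lambda>i. family_det m (take i C @ drop (Suc i) C)"
  have "C ! i \<in> carrier (vec_dual m)" if "i \<in> {..<Suc m}" for i using that C by auto
  then have "tropically_vanishing ((\<lambda>i. signed_abs v ((- 1) ^ i * ?d i) * N (C ! i)) ` {..<Suc m})"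
    by (intro seminorm_of_relation_vanishes[OF nonarch N] cramer_relation[OF C]) auto
  then show "tropically_vanishing ((\<lambda>i. (- 1) ^ i * N (C ! i) * signed_abs v (?d i)) ` {..<Suc m})"
    by (simp add: signed_abs_sign[OF nonarch] mult_ac)
qed

text \<open>In the tuple that consists of \<open>f\<close> and a basis, every determinant is a multiple of \<open>det(b) \<noteq> 0\<close> by a
  known coefficient, so that the factor \<open>\<plusminus> \<bar>det(b)\<bar>\<close> can be cancelled from the condition.\<close>

lemma circuit_condition_expansion:
  assumes nonarch: "nonarch_absolute_value v" and y: "circuit_condition v m y"
    and bs: "length bs = m" "set bs \<subseteq> carrier (vec_dual m)" "family_det m bs \<noteq> 0"
    and f: "f \<in> carrier (vec_dual m)"
    and expansion: "\<And>x. x \<in> carrier_vec m \<Longrightarrow> f x = (\<Sum>j<m. a j * (bs ! j) x)"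
  shows "tropically_vanishing (insert (y f) ((\<lambda>j. - (signed_abs v (a j) * y (bs ! j))) ` {..<m}))"
proof -
  let ?C = "f # bs" and ?d = "family_det m bs"
  let ?t = "\<lambda>i. (- 1) ^ i * y (?C ! i) * signed_abs v (family_det m (take i ?C @ drop (Suc i) ?C))"
  have sign: "(- 1) ^ j * ((- 1) ^ j * r) = r" for j and r :: real
    by (cases "even j") simp_all
  have "?t 0 = signed_abs v ?d * y f" by simp
  moreover have "?t (Suc j) = signed_abs v ?d * - (signed_abs v (a j) * y (bs ! j))" if "j < m" for j
  proof -
    have "?t (Suc j) = - ((- 1) ^ j * y (bs ! j) * signed_abs v ((- 1) ^ j * (a j * ?d)))"
      using deleted_minors_of_expansion[OF bs f that expansion] by (simp add: mult.assoc)
    also have "\<dots> = - ((- 1) ^ j * ((- 1) ^ j * (y (bs ! j) * (signed_abs v (a j) * signed_abs v ?d))))"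
      unfolding signed_abs_sign[OF nonarch] signed_abs_mult[OF nonarch, of "a j"]
      by (simp only: mult_ac)
    finally show ?thesis unfolding sign by (simp add: mult_ac)
  qed
  ultimately have "?t ` {..<Suc m} =
      (*) (signed_abs v ?d) ` insert (y f) ((\<lambda>j. - (signed_abs v (a j) * y (bs ! j))) ` {..<m})"
    unfolding lessThan_Suc_eq_insert_0 image_insert image_image by (intro arg_cong2[of _ _ _ _ insert] image_cong) auto
  moreover have "tropically_vanishing (?t ` {..<Suc m})"
    by (rule y[unfolded circuit_condition_def, rule_format]) (use bs(1,2) f in simp)
  moreover have "signed_abs v ?d \<noteq> 0" using bs(3) signed_abs_eq_0_iff[OF nonarch] by simp
  ultimately show ?thesis using tropically_vanishing_scale by metis
qed

lemma vec_dual_zero_cases: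
  assumes "f \<in> carrier (vec_dual m)"
  obtains i where "i < m" "f (unit_vec m i) \<noteq> 0" | "\<And>x. x \<in> carrier_vec m \<Longrightarrow> f x = 0"
proof (cases "\<exists>i<m. f (unit_vec m i) \<noteq> 0")
  case True
  then show ?thesis using that(1) by blast
next
  case False
  have "f x = 0" if "x \<in> carrier_vec m" for x
    unfolding vec_dual_expansion[OF assms that] using False by (intro sum.neutral) simp
  then show ?thesis by (rule that(2))
qed

text \<open>The expansion of \<open>c f\<close> in a basis that starts with \<open>f\<close>. The case \<open>c = 0\<close> is included, and gives the
  value \<open>0\<close> at the zero functional, which lies in no basis.\<close>

lemma circuit_condition_homogeneous_nonzero:
  assumes nonarch: "nonarch_absolute_value v" and y: "circuit_condition v m y"
    and f: "f \<in> carrier (vec_dual m)" and i: "i < m" "f (unit_vec m i) \<noteq> 0"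
  shows "y (c \<odot>\<^bsub>vec_dual m\<^esub> f) = signed_abs v c * y f"
proof -
  obtain hs where bs: "length (f # hs) = m" "set (f # hs) \<subseteq> carrier (vec_dual m)"
      "family_det m (f # hs) \<noteq> 0"
    using complete_nonzero_functional[OF f i] by blast
  let ?cf = "c \<odot>\<^bsub>vec_dual m\<^esub> f" and ?a = "\<lambda>j. if j = 0 then c else 0"
  have m: "m = Suc (length hs)" using bs(1) by simp
  let ?X = "insert (y ?cf) ((\<lambda>j. - (signed_abs v (?a j) * y ((f # hs) ! j))) ` {..<m})"
  have vanishing: "tropically_vanishing ?X"
  proof (rule circuit_condition_expansion[OF nonarch y bs vec_dual_scale_closed[OF f]])
    fix x :: "'a vec" assume "x \<in> carrier_vec m"
    then show "?cf x = (\<Sum>j<m. ?a j * ((f # hs) ! j) x)"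
      unfolding m by (simp add: vec_dual_ops sum.lessThan_Suc_shift del: sum.lessThan_Suc)
  qed
  have bound: "?X \<subseteq> {y ?cf, - (signed_abs v c * y f), 0}"
    by (auto simp: signed_abs_0[OF nonarch])
  have member: "- (signed_abs v c * y f) \<in> ?X"
    unfolding m by (intro insertI2 rev_image_eqI[of 0]) simp_all
  have "y ?cf = - (- (signed_abs v c * y f))"
    by (rule tropically_vanishing_two[OF vanishing bound _ member]) simp
  then show ?thesis by simp
qed

lemma circuit_condition_zero:
  assumes nonarch: "nonarch_absolute_value v" and y: "circuit_condition v m y" and "0 < m"
    and f: "f \<in> carrier (vec_dual m)" and zero: "\<And>x. x \<in> carrier_vec m \<Longrightarrow> f x = 0"
  shows "y f = 0"
proof -
  have "coordinate m 0 (unit_vec m 0) \<noteq> (0 :: 'a)" using \<open>0 < m\<close> by (simp add: coordinate_def)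
  from circuit_condition_homogeneous_nonzero[OF nonarch y coordinate_in_vec_dual[OF \<open>0 < m\<close>] \<open>0 < m\<close> this, of 0]
  have "y (0 \<odot>\<^bsub>vec_dual m\<^esub> coordinate m 0) = 0" by (simp add: signed_abs_0[OF nonarch])
  moreover have "0 \<odot>\<^bsub>vec_dual m\<^esub> coordinate m 0 = f"
    using zero by (intro vec_dual_eqI[OF vec_dual_scale_closed[OF coordinate_in_vec_dual[OF \<open>0 < m\<close>]] f])
      (simp add: vec_dual_ops)
  ultimately show ?thesis by simp
qed

lemma circuit_condition_homogeneous:
  assumes nonarch: "nonarch_absolute_value v" and y: "circuit_condition v m y" and m: "0 < m"
    and f: "f \<in> carrier (vec_dual m)"
  shows "y (c \<odot>\<^bsub>vec_dual m\<^esub> f) = signed_abs v c * y f"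
  using f
proof (cases rule: vec_dual_zero_cases)
  case 1
  then show ?thesis by (rule circuit_condition_homogeneous_nonzero[OF nonarch y f])
next
  case 2
  then have "y f = 0" by (rule circuit_condition_zero[OF nonarch y m f])
  moreover have "y (c \<odot>\<^bsub>vec_dual m\<^esub> f) = 0"
    by (rule circuit_condition_zero[OF nonarch y m vec_dual_scale_closed[OF f]])
      (simp add: vec_dual_ops 2)
  ultimately show ?thesis by simp
qed

text \<open>The expansion of \<open>f + g\<close> in a basis that starts with \<open>f, g\<close>.\<close>

lemma circuit_condition_add_independent:
  assumes nonarch: "nonarch_absolute_value v" and y: "circuit_condition v m y"
    and f: "f \<in> carrier (vec_dual m)" and g: "g \<in> carrier (vec_dual m)"
    and ij: "i < m" "j < m" "f (unit_vec m i) * g (unit_vec m j) \<noteq> f (unit_vec m j) * g (unit_vec m i)"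
  shows "min (y f) (y g) \<le> y (f \<oplus>\<^bsub>vec_dual m\<^esub> g) \<and> y (f \<oplus>\<^bsub>vec_dual m\<^esub> g) \<le> max (y f) (y g)"
proof -
  obtain hs where bs: "length (f # g # hs) = m" "set (f # g # hs) \<subseteq> carrier (vec_dual m)"
      "family_det m (f # g # hs) \<noteq> 0"
    using complete_independent_pair[OF f g ij] by blast
  let ?fg = "f \<oplus>\<^bsub>vec_dual m\<^esub> g" and ?a = "\<lambda>j. if j < 2 then 1 else 0 :: 'a"
  have m: "m = Suc (Suc (length hs))" using bs(1) by simp
  let ?X = "insert (y ?fg) ((\<lambda>j. - (signed_abs v (?a j) * y ((f # g # hs) ! j))) ` {..<m})"
  have vanishing: "tropically_vanishing ?X"
  proof (rule circuit_condition_expansion[OF nonarch y bs vec_dual_add_closed[OF f g]])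
    fix x :: "'a vec" assume "x \<in> carrier_vec m"
    then show "?fg x = (\<Sum>j<m. ?a j * ((f # g # hs) ! j) x)"
      unfolding m by (simp add: vec_dual_ops sum.lessThan_Suc_shift del: sum.lessThan_Suc)
  qed
  have bound: "?X \<subseteq> {y ?fg, - y f, - y g, 0}"
  proof (intro insert_subsetI image_subsetI)
    fix j :: nat
    consider "j = 0" | "j = 1" | "\<not> j < 2" by linarith
    then show "- (signed_abs v (?a j) * y ((f # g # hs) ! j)) \<in> {y ?fg, - y f, - y g, 0}"
      by cases (simp_all add: signed_abs_0[OF nonarch] signed_abs_1[OF nonarch])
  qed simp
  have member_f: "- y f \<in> ?X"
    unfolding m by (intro insertI2 rev_image_eqI[of 0]) (simp_all add: signed_abs_1[OF nonarch])
  have member_g: "- y g \<in> ?X"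
    unfolding m by (intro insertI2 rev_image_eqI[of 1]) (simp_all add: signed_abs_1[OF nonarch])
  show ?thesis
    by (rule tropically_vanishing_three_between[OF vanishing bound _ member_f member_g]) simp
qed

text \<open>A pair of functionals without a nonzero minor is proportional, and then
  the inequalities reduce to those for \<open>1\<close> and \<open>c\<close> in \<open>K\<close>, multiplied by \<open>y(f)\<close>.\<close>

lemma circuit_condition_add:
  assumes nonarch: "nonarch_absolute_value v" and compat: "order_compatible v"
    and y: "circuit_condition v m y" and m: "0 < m"
    and f: "f \<in> carrier (vec_dual m)" and g: "g \<in> carrier (vec_dual m)"
  shows "min (y f) (y g) \<le> y (f \<oplus>\<^bsub>vec_dual m\<^esub> g) \<and> y (f \<oplus>\<^bsub>vec_dual m\<^esub> g) \<le> max (y f) (y g)"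
  using f
proof (cases rule: vec_dual_zero_cases)
  case (1 i)
  let ?u = "unit_vec m"
  show ?thesis
  proof (cases "\<exists>j<m. f (?u i) * g (?u j) \<noteq> f (?u j) * g (?u i)")
    case True
    then show ?thesis using circuit_condition_add_independent[OF nonarch y f g 1(1)] by blast
  next
    case False
    define c where "c = g (?u i) / f (?u i)"
    have coord: "g (?u j) = c * f (?u j)" if "j < m" for j
    proof -
      have "f (?u i) * g (?u j) = f (?u j) * g (?u i)" using False that by blast
      then show ?thesis using 1(2) by (simp add: c_def field_simps)
    qed
    have gx: "g x = c * f x" if "x \<in> carrier_vec m" for x
      unfolding vec_dual_expansion[OF f that] vec_dual_expansion[OF g that] sum_distrib_left
      by (rule sum.cong) (simp_all add: coord mult_ac)
    have "g = c \<odot>\<^bsub>vec_dual m\<^esub> f"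
      by (rule vec_dual_eqI[OF g vec_dual_scale_closed[OF f]]) (simp add: gx vec_dual_ops)
    then have yg: "y g = signed_abs v c * y f"
      using circuit_condition_homogeneous[OF nonarch y m f] by simp
    have "f \<oplus>\<^bsub>vec_dual m\<^esub> g = (1 + c) \<odot>\<^bsub>vec_dual m\<^esub> f"
      by (rule vec_dual_eqI[OF vec_dual_add_closed[OF f g] vec_dual_scale_closed[OF f]])
        (simp add: gx vec_dual_ops distrib_right)
    then have yfg: "y (f \<oplus>\<^bsub>vec_dual m\<^esub> g) = signed_abs v (1 + c) * y f"
      using circuit_condition_homogeneous[OF nonarch y m f] by simp
    have between: "min 1 (signed_abs v c) \<le> signed_abs v (1 + c)" "signed_abs v (1 + c) \<le> max 1 (signed_abs v c)"
      using signed_abs_add_between[OF nonarch compat, of 1 c] by (simp_all add: signed_abs_1[OF nonarch])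
    show ?thesis
    proof (cases "0 \<le> y f")
      case True
      then show ?thesis
        using mult_right_mono[OF between(1) True] mult_right_mono[OF between(2) True]
        unfolding yg yfg by (simp add: min_mult_distrib_right max_mult_distrib_right)
    next
      case False
      then have "y f \<le> 0" by simp
      then show ?thesis
        using mult_right_mono_neg[OF between(1) \<open>y f \<le> 0\<close>]
          mult_right_mono_neg[OF between(2) \<open>y f \<le> 0\<close>] False
        unfolding yg yfg by (simp add: min_mult_distrib_right max_mult_distrib_right)
    qed
  qed
next
  case 2
  have "f \<oplus>\<^bsub>vec_dual m\<^esub> g = g"
    by (rule vec_dual_eqI[OF vec_dual_add_closed[OF f g] g]) (simp add: vec_dual_ops 2)
  then show ?thesis by simp
qed

lemma signed_seminorm_iff_circuit_condition:
  assumes nonarch: "nonarch_absolute_value v" and compat: "order_compatible v" and m: "0 < m"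
    and y: "y \<in> carrier (vec_dual m) \<rightarrow>\<^sub>E UNIV"
  shows "signed_seminorm v (vec_dual m) y \<longleftrightarrow> circuit_condition v m y"
proof
  assume circuits: "circuit_condition v m y"
  show "signed_seminorm v (vec_dual m) y"
    unfolding signed_seminorm_def
  proof (intro conjI allI ballI)
    fix f g :: "'a vec \<Rightarrow> 'a"
    assume f: "f \<in> carrier (vec_dual m)"
    show "y (c \<odot>\<^bsub>vec_dual m\<^esub> f) = sgn_real c * v c * y f" for c
      using circuit_condition_homogeneous[OF nonarch circuits m f] by (simp only: signed_abs_def)
    assume g: "g \<in> carrier (vec_dual m)"
    show "min (y f) (y g) \<le> y (f \<oplus>\<^bsub>vec_dual m\<^esub> g)" "y (f \<oplus>\<^bsub>vec_dual m\<^esub> g) \<le> max (y f) (y g)"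
      using circuit_condition_add[OF nonarch compat circuits m f g] by blast+
  qed (rule y)
qed (rule circuit_condition_of_seminorm[OF nonarch])

section \<open>Projective space as a quotient by homotheties\<close>

lemma homothety_class_eq_iff:
  assumes "y \<in> E \<rightarrow>\<^sub>E UNIV" "z \<in> E \<rightarrow>\<^sub>E UNIV"
  shows "homothety_class E y = homothety_class E z \<longleftrightarrow> (\<exists>c. c \<noteq> 0 \<and> z = (\<lambda>e\<in>E. c * y e))"
proof
  have "z = (\<lambda>e\<in>E. 1 * z e)" using assms(2) by (auto simp: PiE_def extensional_restrict)
  then have "z \<in> homothety_class E z" unfolding homothety_class_def by (auto intro!: exI[of _ 1])
  moreover assume "homothety_class E y = homothety_class E z"
  ultimately have "z \<in> homothety_class E y" by simp
  then show "\<exists>c. c \<noteq> 0 \<and> z = (\<lambda>e\<in>E. c * y e)" by (simp add: homothety_class_def)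
next
  assume "\<exists>c. c \<noteq> 0 \<and> z = (\<lambda>e\<in>E. c * y e)"
  then obtain c where c: "c \<noteq> 0" "z = (\<lambda>e\<in>E. c * y e)" by blast
  have "\<exists>d. d \<noteq> 0 \<and> (\<lambda>e\<in>E. b * y e) = (\<lambda>e\<in>E. d * z e)" if "b \<noteq> 0" for b
    using c that by (intro exI[of _ "b / c"]) (auto intro!: restrict_ext)
  moreover have "\<exists>d. d \<noteq> 0 \<and> (\<lambda>e\<in>E. b * z e) = (\<lambda>e\<in>E. d * y e)" if "b \<noteq> 0" for b
    using c that by (intro exI[of _ "b * c"]) (auto intro!: restrict_ext)
  ultimately show "homothety_class E y = homothety_class E z"
    unfolding homothety_class_def by (intro Collect_cong iffI; elim exE conjE; simp only:)
qed

lemma homothety_nonzero_function: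
  assumes "y \<in> nonzero_functions E" "c \<noteq> 0"
  shows "(\<lambda>e\<in>E. c * y e) \<in> nonzero_functions E"
proof -
  have y: "y \<in> E \<rightarrow>\<^sub>E UNIV" "y \<noteq> (\<lambda>e\<in>E. 0)" using assms(1) by (auto simp: nonzero_functions_def)
  have "\<exists>e\<in>E. y e \<noteq> 0"
  proof (rule ccontr)
    assume "\<not> (\<exists>e\<in>E. y e \<noteq> 0)"
    then have "y = (\<lambda>e\<in>E. 0)" using y(1) by (intro PiE_ext[where s="\<lambda>_. UNIV"]) auto
    with y(2) show False ..
  qed
  then obtain e where "e \<in> E" "y e \<noteq> 0" by blast
  then have "(\<lambda>e\<in>E. c * y e) e \<noteq> (\<lambda>e\<in>E. 0) e" using assms(2) by simp
  then show ?thesis unfolding nonzero_functions_def by (auto dest: fun_cong)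
qed

lemma topspace_nonzero_functions:
  "topspace (subtopology (powertop_real E) (nonzero_functions E)) = nonzero_functions E"
  by (auto simp: nonzero_functions_def)

lemma continuous_homothety:
  assumes "c \<noteq> 0"
  shows "continuous_map (subtopology (powertop_real E) (nonzero_functions E))
    (subtopology (powertop_real E) (nonzero_functions E)) (\<lambda>y. \<lambda>e\<in>E. c * y e)"
  unfolding continuous_map_in_subtopology topspace_nonzero_functions
proof
  have "continuous_map (subtopology (powertop_real E) (nonzero_functions E)) euclideanreal
      (\<lambda>y. c * y e)" if "e \<in> E" for e
    using that by (intro continuous_intros)
  then show "continuous_map (subtopology (powertop_real E) (nonzero_functions E)) (powertop_real E)
      (\<lambda>y. \<lambda>e\<in>E. c * y e)"
    by (auto simp: continuous_map_componentwise)
  show "(\<lambda>y. \<lambda>e\<in>E. c * y e) \<in> nonzero_functions E \<rightarrow> nonzero_functions E"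
    using homothety_nonzero_function[OF _ assms] by blast
qed

text \<open>The saturation of an open set is the union of its images under all homotheties, each of which is open.\<close>

lemma open_map_homothety_class:
  "open_map (subtopology (powertop_real E) (nonzero_functions E)) (RP_topology E) (homothety_class E)"
  (is "open_map ?X _ _")
  unfolding open_map_def
proof (intro allI impI)
  fix U assume U: "openin ?X U"
  let ?q = "homothety_class E"
  have sub: "U \<subseteq> nonzero_functions E" using openin_subset[OF U] topspace_nonzero_functions by blast
  have eq: "{y \<in> nonzero_functions E. ?q y \<in> ?q ` U} =
      (\<Union>c\<in>- {0}. {y \<in> nonzero_functions E. (\<lambda>e\<in>E. c * y e) \<in> U})"
  proof (intro equalityI subsetI)
    fix y assume "y \<in> {y \<in> nonzero_functions E. ?q y \<in> ?q ` U}"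
    then obtain u where u: "y \<in> nonzero_functions E" "u \<in> U" "?q y = ?q u" by blast
    then have "\<exists>c. c \<noteq> 0 \<and> u = (\<lambda>e\<in>E. c * y e)"
      using sub by (subst homothety_class_eq_iff[symmetric]) (auto simp: nonzero_functions_def)
    then show "y \<in> (\<Union>c\<in>- {0}. {y \<in> nonzero_functions E. (\<lambda>e\<in>E. c * y e) \<in> U})" using u by auto
  next
    fix y assume "y \<in> (\<Union>c\<in>- {0}. {y \<in> nonzero_functions E. (\<lambda>e\<in>E. c * y e) \<in> U})"
    then obtain c where c: "c \<noteq> 0" "y \<in> nonzero_functions E" "(\<lambda>e\<in>E. c * y e) \<in> U" by auto
    then have "?q y = ?q (\<lambda>e\<in>E. c * y e)"
      by (subst homothety_class_eq_iff) (auto simp: nonzero_functions_def)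
    then show "y \<in> {y \<in> nonzero_functions E. ?q y \<in> ?q ` U}" using c by blast
  qed
  have "openin ?X {y \<in> nonzero_functions E. (\<lambda>e\<in>E. c * y e) \<in> U}" if "c \<noteq> 0" for c
    using openin_continuous_map_preimage[OF continuous_homothety[OF that] U]
    by (simp only: topspace_nonzero_functions)
  then have "openin ?X {y \<in> nonzero_functions E. ?q y \<in> ?q ` U}" unfolding eq by blast
  then show "openin (RP_topology E) (?q ` U)"
    unfolding RP_topology_def openin_quotient_topology topspace_nonzero_functions using sub by blast
qed

lemma quotient_topology_unique:
  assumes "quotient_map X Y q" "quotient_map X Z q"
  shows "Y = Z"
proof (rule topology_eq[THEN iffD2], intro allI)
  fix U
  have top: "topspace Y = topspace Z" using assms by (simp add: quotient_map_def)
  have Y: "openin Y U \<longleftrightarrow> openin X {x \<in> topspace X. q x \<in> U}" if "U \<subseteq> topspace Y"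
    using assms(1) that by (simp add: quotient_map_def)
  have Z: "openin Z U \<longleftrightarrow> openin X {x \<in> topspace X. q x \<in> U}" if "U \<subseteq> topspace Z"
    using assms(2) that by (simp add: quotient_map_def)
  show "openin Y U \<longleftrightarrow> openin Z U"
  proof (cases "U \<subseteq> topspace Y")
    case True
    then show ?thesis using Y Z top by simp
  next
    case False
    then show ?thesis using openin_subset[of Y U] openin_subset[of Z U] top by blast
  qed
qed

text \<open>In general a quotient map does not restrict to a quotient map on a subset. It does here because the
  projection is open and the subset is saturated.\<close>

lemma quotient_of_saturated_subset:
  assumes S: "S \<subseteq> nonzero_functions E"
    and saturated: "\<And>y c. y \<in> S \<Longrightarrow> c \<noteq> 0 \<Longrightarrow> (\<lambda>e\<in>E. c * y e) \<in> S"
  shows "quotient_topology (subtopology (powertop_real E) S) (homothety_class E) =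
    subtopology (RP_topology E) (homothety_class E ` S)"
proof (rule quotient_topology_unique[OF quotient_map_quotient_topology])
  let ?X = "subtopology (powertop_real E) (nonzero_functions E)"
  let ?q = "homothety_class E"
  have XS: "subtopology (powertop_real E) S = subtopology ?X S"
    using S by (simp add: subtopology_subtopology Int_absorb1)
  have preimage: "{y \<in> topspace ?X. ?q y \<in> ?q ` S} = S"
  proof (intro equalityI subsetI)
    fix y assume "y \<in> {y \<in> topspace ?X. ?q y \<in> ?q ` S}"
    then obtain s where s: "y \<in> nonzero_functions E" "s \<in> S" "?q s = ?q y"
      unfolding topspace_nonzero_functions by auto
    then have "\<exists>c. c \<noteq> 0 \<and> y = (\<lambda>e\<in>E. c * s e)"
      using S by (subst homothety_class_eq_iff[symmetric]) (auto simp: nonzero_functions_def)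
    then show "y \<in> S" using saturated s(2) by blast
  qed (use S topspace_nonzero_functions in blast)
  have qX: "quotient_map ?X (RP_topology E) ?q"
    unfolding RP_topology_def by (rule quotient_map_quotient_topology)
  show "quotient_map (subtopology (powertop_real E) S) (subtopology (RP_topology E) (?q ` S)) ?q"
    unfolding XS
  proof (rule continuous_open_imp_quotient_map)
    show "continuous_map (subtopology ?X S) (subtopology (RP_topology E) (?q ` S)) ?q"
      using quotient_imp_continuous_map[OF qX]
      by (auto simp: continuous_map_in_subtopology continuous_map_from_subtopology)
    show "open_map (subtopology ?X S) (subtopology (RP_topology E) (?q ` S)) ?q"
      by (rule open_map_restriction[OF open_map_homothety_class preimage])
    have "topspace (RP_topology E) = ?q ` nonzero_functions E"
      unfolding RP_topology_def topspace_quotient_topology topspace_nonzero_functions ..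
    then show "?q ` topspace (subtopology ?X S) = topspace (subtopology (RP_topology E) (?q ` S))"
      unfolding topspace_subtopology[of ?X] topspace_nonzero_functions topspace_subtopology[of "RP_topology E"]
      using S by blast
  qed
qed

section \<open>The signed Goldman-Iwahori space as a tropical linear space\<close>

lemma nonzero_functions_iff:
  "y \<in> nonzero_functions E \<longleftrightarrow> y \<in> E \<rightarrow>\<^sub>E UNIV \<and> (\<exists>e\<in>E. y e \<noteq> 0)"
proof -
  have "y = (\<lambda>e\<in>E. 0) \<longleftrightarrow> (\<forall>e\<in>E. y e = 0)" if y: "y \<in> E \<rightarrow>\<^sub>E UNIV"
  proof
    assume "\<forall>e\<in>E. y e = 0"
    then show "y = (\<lambda>e\<in>E. 0)" by (intro PiE_ext[OF y]) auto
  qed simp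
  then show ?thesis unfolding nonzero_functions_def by blast
qed

lemma nonzero_signed_seminorms_iff:
  "N \<in> nonzero_signed_seminorms v n \<longleftrightarrow>
     N \<in> nonzero_functions (carrier (std_dual n)) \<and> signed_seminorm v (std_dual n) N"
  unfolding nonzero_functions_iff nonzero_signed_seminorms_def signed_seminorm_def by blast

text \<open>The two spaces agree already at the level of representatives, before passing to homothety classes.\<close>

lemma nonzero_signed_seminorms_eq_trop:
  assumes nonarch: "nonarch_absolute_value v" and compat: "order_compatible v"
  shows "nonzero_signed_seminorms v n = {y \<in> nonzero_functions (carrier (std_dual n)).
     \<forall>C. length C = n + 1 + 1 \<and> set C \<subseteq> carrier (std_dual n) \<longrightarrow>
       0 \<in> rt_sum (map (\<lambda>i. (- 1) ^ i * y (C ! i) * phi_univ v n (take i C @ drop (Suc i) C)) [0..<n + 1 + 1])}"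
proof -
  have phi: "phi_univ v n fs = signed_abs v (family_det (n + 1) fs)" for fs
    by (simp add: phi_univ_def signed_abs_def functional_det_eq)
  have sum: "0 \<in> rt_sum (map t [0..<n + 1 + 1]) \<longleftrightarrow> tropically_vanishing (t ` {..<Suc (n + 1)})" for t
  proof -
    have nonempty: "map t [0..<n + 1 + 1] \<noteq> []" by simp
    have "set (map t [0..<n + 1 + 1]) = t ` {..<Suc (n + 1)}"
      unfolding set_map set_upt atLeast0LessThan by simp
    then show ?thesis using zero_in_rt_sum_iff[OF nonempty] by (simp only:)
  qed
  have member: "N \<in> nonzero_signed_seminorms v n \<longleftrightarrow>
      N \<in> nonzero_functions (carrier (std_dual n)) \<and> circuit_condition v (n + 1) N" for N
    unfolding nonzero_signed_seminorms_iff
    by (intro conj_cong[OF refl] signed_seminorm_iff_circuit_condition[OF nonarch compat])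
      (simp_all add: nonzero_functions_def)
  have circuits: "circuit_condition v (n + 1) N \<longleftrightarrow>
      (\<forall>C. length C = n + 1 + 1 \<and> set C \<subseteq> carrier (std_dual n) \<longrightarrow>
        0 \<in> rt_sum (map (\<lambda>i. (- 1) ^ i * N (C ! i) * phi_univ v n (take i C @ drop (Suc i) C)) [0..<n + 1 + 1]))" for N
    unfolding sum phi circuit_condition_def by simp
  show ?thesis by (rule Set.set_eqI) (unfold mem_Collect_eq member circuits, rule refl)
qed

lemma homothetic_nonzero_signed_seminorm:
  assumes "N \<in> nonzero_signed_seminorms v n" "c \<noteq> 0"
  shows "(\<lambda>f\<in>carrier (std_dual n). c * N f) \<in> nonzero_signed_seminorms v n"
  using assms unfolding nonzero_signed_seminorms_iff
  by (intro conjI homothety_nonzero_function homothetic_seminorm) blast+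

theorem theorem0p2:
  fixes v :: "'k::linordered_field \<Rightarrow> real" and n :: nat
  assumes "real_closed TYPE('k)"
    and "nonarch_absolute_value v"
    and "order_compatible v"
  shows "signed_GI_space v n \<subseteq> topspace (RP_topology (carrier (std_dual n)))
    \<and> signed_GI_space v n = trop_univ v n
    \<and> signed_GI_topology v n =
        subtopology (RP_topology (carrier (std_dual n))) (trop_univ v n)"
proof (intro conjI)
  have sub: "nonzero_signed_seminorms v n \<subseteq> nonzero_functions (carrier (std_dual n))"
    using nonzero_signed_seminorms_iff by blast
  show "signed_GI_space v n \<subseteq> topspace (RP_topology (carrier (std_dual n)))"
    unfolding signed_GI_space_def RP_topology_def topspace_quotient_topology topspace_nonzero_functions
    using sub by blast
  show eq: "signed_GI_space v n = trop_univ v n"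
    unfolding signed_GI_space_def trop_univ_def trop_real_def
      nonzero_signed_seminorms_eq_trop[OF assms(2,3)] ..
  show "signed_GI_topology v n = subtopology (RP_topology (carrier (std_dual n))) (trop_univ v n)"
    unfolding eq[symmetric] signed_GI_topology_def signed_GI_space_def
    by (rule quotient_of_saturated_subset[OF sub homothetic_nonzero_signed_seminorm])
qed

end
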